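(* Consider the BilateralMatch(H) policy $\mathcal{B}_H$ and fix $\lambda_E>0$ and $p_E\in(0,1]$. The limiting average waiting time $\lim_{p_H\to0}p_H^2\,w_H^{\mathcal{B}_H}$ of $H$ agents, as a function of $\lambda_H$, increases with $\lambda_H$ in the interval $\lambda_E<\lambda_H<x^*\lambda_E$, and decreases with $\lambda_H$ in the interval $\lambda_H>x^*\lambda_E$, where $x^*\approx2.18$ is the unique solution of $$(x+1)\ln\left(2-\frac{2}{x+1}\right)=1.$$
   Context: Model: agents of two types $H$ (hard-to-match) and $E$ (easy-to-match) arrive to a market according to independent Poisson processes with rates $\lambda_H,\lambda_E>0$. Each agent owns an item; an agent of type $T\in\{H,E\}$ finds the item of any other agent compatible with probability $p_T$, independently over all ordered pairs. Here $p_E\in(0,1]$ is a fixed constant and $p_H\in(0,1)$ is a parameter tending to $0$. Two agents can form a bilateral exchange (2-cycle) if each finds the other's item compatible. Policy BilateralMatch(H) ($\mathcal{B}_H$): upon arrival of a new agent, if a 2-cycle can be formed between it and a waiting agent, one such cycle is executed and both agents leave; if there are several such cycles, priority is given to cycles whose waiting agent is of type $H$, further ties being broken uniformly at random. Otherwise the new agent joins the market and waits. The numbers $[H_t,E_t]\in\mathbb{N}^2$ of waiting $H$ and $E$ agents form a positive recurrent continuous-time Markov chain with transition rates (convention $0^0=1$) $Q([h,e],[h+1,e])=\lambda_H(1-p_H^2)^h(1-p_Ep_H)^e$, $Q([h,e],[h-1,e])=\lambda_H(1-(1-p_H^2)^h)+\lambda_E(1-(1-p_Ep_H)^h)$, $Q([h,e],[h,e+1])=\lambda_E(1-p_Ep_H)^h(1-p_E^2)^e$,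 $Q([h,e],[h,e-1])=\lambda_H(1-p_H^2)^h(1-(1-p_Ep_H)^e)+\lambda_E(1-p_Ep_H)^h(1-(1-p_E^2)^e)$. $[H^{\mathcal{B}_H},E^{\mathcal{B}_H}]$ has the stationary distribution, and the steady-state average waiting time of $H$ agents is $w_H^{\mathcal{B}_H}=\mathbb{E}[H^{\mathcal{B}_H}]/\lambda_H$ (Little's law). For $\lambda_H>\lambda_E$ the waiting time scales as $1/p_H^2$, and "limiting average waiting time" means $\lim_{p_H\to0}p_H^2\,w_H^{\mathcal{B}_H}$. *)

theory Defs
  imports "HOL-Probability.Probability"
begin

text \<open>
  Rates \<open>Q s t\<close> are off-diagonal jump rates (\<open>Q s s = 0\<close>). A distribution is stationary
  iff total probability inflow equals total outflow at every state; for bounded exit rates (as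
  for the chain below, where they are at most \<open>lamH + lamE\<close>) this is invariance under the
  Markov semigroup.
\<close>

definition stationary_for :: "('s \<Rightarrow> 's \<Rightarrow> real) \<Rightarrow> 's pmf \<Rightarrow> bool" where
  "stationary_for Q \<pi> \<longleftrightarrow>
     (\<forall>s. ((\<lambda>t. pmf \<pi> t * Q t s) has_sum (pmf \<pi> s * (\<Sum>\<^sub>\<infinity>t. Q s t))) UNIV)"

text \<open>
  A state \<open>(h, e)\<close> counts the waiting H and E agents. A decrease is matched as
  \<open>h = h' + 1\<close>, so that no truncated subtraction occurs and there is no decrease from 0.
\<close>

definition rate_BH :: "real \<Rightarrow> real \<Rightarrow> real \<Rightarrow> real \<Rightarrow> nat \<times> nat \<Rightarrow> nat \<times> nat \<Rightarrow> real" where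
  "rate_BH lamH lamE pH pE = (\<lambda>(h, e) (h', e').
     if h' = h + 1 \<and> e' = e then
       lamH * (1 - pH\<^sup>2) ^ h * (1 - pE * pH) ^ e
     else if h = h' + 1 \<and> e' = e then
       lamH * (1 - (1 - pH\<^sup>2) ^ h) + lamE * (1 - (1 - pE * pH) ^ h)
     else if h' = h \<and> e' = e + 1 then
       lamE * (1 - pE * pH) ^ h * (1 - pE\<^sup>2) ^ e
     else if h' = h \<and> e = e' + 1 then
       lamH * (1 - pH\<^sup>2) ^ h * (1 - (1 - pE * pH) ^ e)
       + lamE * (1 - pE * pH) ^ h * (1 - (1 - pE\<^sup>2) ^ e)
     else 0)"

definition stationary_BH :: "real \<Rightarrow> real \<Rightarrow> real \<Rightarrow> real \<Rightarrow> (nat \<times> nat) pmf" where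
  "stationary_BH lamH lamE pH pE = (THE \<pi>. stationary_for (rate_BH lamH lamE pH pE) \<pi>)"

text \<open>Steady-state average waiting time of H agents, through Little's law.\<close>

definition wait_H_BH :: "real \<Rightarrow> real \<Rightarrow> real \<Rightarrow> real \<Rightarrow> real" where
  "wait_H_BH lamH lamE pH pE =
     measure_pmf.expectation (stationary_BH lamH lamE pH pE) (\<lambda>(h, e). real h) / lamH"

end

theory Submission
  imports
    Defs
    "HOL-Complex_Analysis.Great_Picard"
    "HOL-Real_Asymp.Real_Asymp"
begin

text \<open>
  On the scale \<open>1 / pH\<^sup>2\<close> almost every arriving \<open>E\<close> agent finds a waiting \<open>H\<close> agent and \<open>E\<close> agents
  hardly ever wait, so \<open>y = pH\<^sup>2 H\<close> has fluid drift \<open>2 lamH exp (- y) - lamH - lamE\<close>, which vanishes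
  at \<open>y = ln (2 lamH / (lamH + lamE))\<close>; thus the limiting waiting time is \<open>y / lamH\<close>, whose
  derivative changes sign at \<open>lamH / lamE = xstar\<close>.

  Concentration of \<open>y\<close> at the zero comes from the stationary balance \<open>E (generator g) = 0\<close> for a
  few test functions \<open>g\<close>. With \<open>r = 1 - pE pH\<close> and \<open>\<rho> = E (r\<^sup>H)\<close>, the functions \<open>e\<close> and \<open>e (e + 1)\<close>
  bound the influence of waiting \<open>E\<close> agents by a multiple of \<open>\<rho>\<close>, the function \<open>r\<^sup>h\<close> gives
  \<open>\<rho> = O(pH)\<close> because \<open>lamE < lamH\<close>, and \<open>(h - m)\<^sup>2\<close> then bounds the deviation of \<open>H\<close> from the
  zero \<open>m\<close> of the drift. The chain has a stationary distribution with exponential moments since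
  \<open>\<kappa> powr - (h + e)\<close> is a Lyapunov function.
\<close>

section \<open>Invariant distributions of Markov kernels\<close>

text \<open>The difference \<open>g - f\<close> has integral 0, so it vanishes at every point, since
  counting measure has no nonempty null sets. Finiteness is what permits subtracting the
  integrals.\<close>

lemma nn_integral_count_space_eq_imp_eq:
  fixes f g :: "'a \<Rightarrow> ennreal"
  assumes le: "\<And>x. f x \<le> g x"
    and eq: "(\<integral>\<^sup>+x. f x \<partial>count_space UNIV) = (\<integral>\<^sup>+x. g x \<partial>count_space UNIV)"
    and fin: "(\<integral>\<^sup>+x. g x \<partial>count_space UNIV) < \<infinity>"
  shows "f x = g x"
proof -
  have "(\<integral>\<^sup>+x. g x - f x \<partial>count_space UNIV) = 0"
    using le eq fin by (subst nn_integral_diff) (auto simp: less_top)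
  then have "g x - f x = 0"
    by (subst (asm) nn_integral_0_iff_AE) (auto simp: AE_count_space)
  then show ?thesis
    using le[of x] by (metis antisym diff_eq_0_iff_ennreal ennreal_minus_eq_0)
qed

text \<open>The pointwise minimum of two invariant distributions is superinvariant with finite mass,
  hence invariant, so the excess of either distribution over it spreads along transitions to
  \<open>s0\<close>, where one of the two excesses vanishes.\<close>

lemma invariant_pmf_unique:
  fixes K :: "'a \<Rightarrow> 'a pmf"
  assumes M: "bind_pmf M K = M" and N: "bind_pmf N K = N"
    and reach: "\<And>s. (s, s0) \<in> {(s, t). t \<in> set_pmf (K s)}\<^sup>*"
  shows "M = N"
proof (rule ccontr)
  define m where "m = (\<lambda>s. min (ennreal (pmf M s)) (ennreal (pmf N s)))"
  \<comment> \<open>\<open>T\<close> is the forward action of \<open>K\<close> on weights. It takes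
    values in \<open>ennreal\<close>, so sums can be swapped and compared before any summability is
    known.\<close>
  define T where "T = (\<lambda>f s. \<integral>\<^sup>+t. f t * ennreal (pmf (K t) s) \<partial>count_space UNIV)"
  have T_inv: "T (\<lambda>t. ennreal (pmf P t)) s = ennreal (pmf P s)" if "bind_pmf P K = P" for P s
    using ennreal_pmf_bind[of P K s] that by (simp add: T_def nn_integral_measure_pmf)
  have T_mono: "T f s \<le> T g s" if "\<And>t. f t \<le> g t" for f g s
    unfolding T_def by (intro nn_integral_mono mult_right_mono that) auto
  have Tm_le: "T m s \<le> m s" for s
    using T_mono[of m "\<lambda>t. ennreal (pmf M t)" s] T_mono[of m "\<lambda>t. ennreal (pmf N t)" s]
    by (simp add: T_inv[OF M] T_inv[OF N]) (simp add: m_def)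
  have fin: "(\<integral>\<^sup>+s. m s \<partial>count_space UNIV) < \<infinity>"
  proof -
    have "(\<integral>\<^sup>+s. m s \<partial>count_space UNIV) \<le> (\<integral>\<^sup>+s. ennreal (pmf M s) \<partial>count_space UNIV)"
      by (intro nn_integral_mono) (simp add: m_def)
    then show ?thesis
      by (simp add: nn_integral_pmf le_less_trans)
  qed
  \<comment> \<open>Swapping the sums shows that \<open>T\<close> preserves total mass, so the
    inequality \<open>T m \<le> m\<close> between finite masses has to be an equality.\<close>
  have "(\<integral>\<^sup>+s. T m s \<partial>count_space UNIV)
      = (\<integral>\<^sup>+t. \<integral>\<^sup>+s. m t * ennreal (pmf (K t) s) \<partial>count_space UNIV \<partial>count_space UNIV)"
    unfolding T_def
    using nn_integral_snd_count_space[of "\<lambda>(t, s). m t * ennreal (pmf (K t) s)"]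
      nn_integral_fst_count_space[of "\<lambda>(t, s). m t * ennreal (pmf (K t) s)"] by simp
  also have "\<dots> = (\<integral>\<^sup>+t. m t \<partial>count_space UNIV)"
    by (simp add: nn_integral_cmult nn_integral_pmf)
  finally have Tm: "T m s = m s" for s
    by (rule nn_integral_count_space_eq_imp_eq[OF Tm_le _ fin])
  \<comment> \<open>If \<open>m\<close> and \<open>P\<close> agreed at the successor
    \<open>s\<close>, their inflows into \<open>s\<close> would agree, hence agree term by term. The
    term of \<open>t\<close> has positive weight, which would force agreement at \<open>t\<close> as
    well.\<close>
  have step: "m t < ennreal (pmf P t) \<Longrightarrow> m s < ennreal (pmf P s)"
    if inv: "bind_pmf P K = P" and le: "\<And>t. m t \<le> ennreal (pmf P t)" and s: "s \<in> set_pmf (K t)"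
    for P t s
  proof (rule ccontr)
    assume lt: "m t < ennreal (pmf P t)" and "\<not> m s < ennreal (pmf P s)"
    then have "m s = ennreal (pmf P s)"
      using le[of s] by simp
    then have "T m s = T (\<lambda>t. ennreal (pmf P t)) s" "T (\<lambda>t. ennreal (pmf P t)) s < \<infinity>"
      by (simp_all add: Tm T_inv[OF inv])
    then have "m t * ennreal (pmf (K t) s) = ennreal (pmf P t) * ennreal (pmf (K t) s)"
      unfolding T_def
      by (rule nn_integral_count_space_eq_imp_eq[where f = "\<lambda>t. m t * ennreal (pmf (K t) s)"
            and g = "\<lambda>t. ennreal (pmf P t) * ennreal (pmf (K t) s)", rotated])
         (simp_all add: mult_right_mono le)
    moreover have "0 < ennreal (pmf (K t) s)"
      using s by (simp add: pmf_positive)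
    ultimately show False
      using lt by (simp add: mult.commute[of _ "ennreal (pmf (K t) s)"] ennreal_mult_cancel_left)
  qed
  have reached: "m s0 < ennreal (pmf P s0)"
    if inv: "bind_pmf P K = P" and le: "\<And>t. m t \<le> ennreal (pmf P t)"
      and s: "m s < ennreal (pmf P s)" for P s
    using reach[of s] by (induction rule: rtrancl_induct) (use s step[OF inv le] in auto)
  assume "M \<noteq> N"
  \<comment> \<open>Both distributions have mass 1, so if they differ, each exceeds the other
    somewhere.\<close>
  then obtain s t where "pmf M s < pmf N s" "pmf N t < pmf M t"
    using pmf_neq_exists_less by metis
  then have "m s < ennreal (pmf N s)" "m t < ennreal (pmf M t)"
    by (simp_all add: m_def ennreal_less_iff min_less_iff_disj)
  then have "m s0 < ennreal (pmf N s0)" "m s0 < ennreal (pmf M s0)"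
    using reached[OF N _ \<open>m s < _\<close>] reached[OF M _ \<open>m t < _\<close>] by (simp_all add: m_def)
  then show False
    by (auto simp: m_def min_def split: if_splits)
qed

text \<open>A pointwise limit of distributions can lose mass at infinity. The last assumption is
  tightness and rules this out.\<close>

lemma pmf_of_tight_weights:
  fixes w :: "'a \<Rightarrow> real"
  assumes nonneg: "\<And>s. 0 \<le> w s"
    and le: "\<And>F. finite F \<Longrightarrow> sum w F \<le> 1"
    and ge: "\<And>\<epsilon>. 0 < \<epsilon> \<Longrightarrow> \<exists>F. finite F \<and> 1 - \<epsilon> \<le> sum w F"
  obtains M where "\<And>s. pmf M s = w s"
proof -
  have summable: "w summable_on UNIV"
    by (rule nonneg_bdd_above_summable_on) (use nonneg le in \<open>auto simp: bdd_above_def\<close>)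
  have "infsum w UNIV \<le> 1"
    by (rule infsum_le_finite_sums[OF summable]) (use le in auto)
  moreover have "1 - \<epsilon> \<le> infsum w UNIV" if \<epsilon>: "0 < \<epsilon>" for \<epsilon>
  proof -
    obtain F where "finite F" "1 - \<epsilon> \<le> sum w F"
      using ge[OF \<epsilon>] by blast
    then show ?thesis
      using finite_sum_le_infsum[OF summable, of F] nonneg by force
  qed
  then have "1 \<le> infsum w UNIV"
    by (metis diff_le_eq field_le_epsilon)
  ultimately have "infsum w UNIV = 1"
    by simp
  moreover have abs: "Infinite_Set_Sum.abs_summable_on w UNIV"
    using summable nonneg by (simp flip: abs_summable_equivalent)
  ultimately have "(\<integral>\<^sup>+s. ennreal (w s) \<partial>count_space UNIV) = 1"
    using nn_integral_conv_infsetsum[OF abs] nonneg by (simp add: infsetsum_infsum)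
  then have "pmf (embed_pmf w) s = w s" for s
    by (intro pmf_embed_pmf nonneg)
  then show thesis
    by (rule that)
qed

lemma sum_pmf_mult_le_nn_integral:
  assumes "finite F" "\<And>s. 0 \<le> f s"
  shows "ennreal (\<Sum>s\<in>F. pmf M s * f s) \<le> (\<integral>\<^sup>+s. ennreal (f s) \<partial>measure_pmf M)"
proof -
  have "ennreal (\<Sum>s\<in>F. pmf M s * f s) = (\<integral>\<^sup>+s. ennreal (pmf M s * f s) * indicator F s \<partial>count_space UNIV)"
    using assms by (subst nn_integral_count_space'[where A = F]) (auto simp: sum_ennreal indicator_def)
  also have "\<dots> \<le> (\<integral>\<^sup>+s. ennreal (f s) \<partial>measure_pmf M)"
    unfolding nn_integral_measure_pmf
    using assms by (intro nn_integral_mono) (auto simp: ennreal_mult indicator_def)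
  finally show ?thesis .
qed

text \<open>Krylov--Bogoliubov: the Cesaro averages of the iterates of a point mass are tight by
  the drift condition. Since every state has finitely many predecessors, invariance passes to a
  pointwise limit.\<close>

lemma invariant_pmf_exists:
  fixes K :: "'a::countable \<Rightarrow> 'a pmf" and f :: "'a \<Rightarrow> real"
  assumes nonneg: "\<And>s. 0 \<le> f s"
    and sublevel: "\<And>c. finite {s. f s \<le> c}"
    and pred: "\<And>s. finite {t. s \<in> set_pmf (K t)}"
    and \<kappa>: "0 \<le> \<kappa>" "\<kappa> < 1" and B: "0 \<le> B"
    and drift: "\<And>s. (\<integral>\<^sup>+t. ennreal (f t) \<partial>K s) \<le> ennreal (\<kappa> * f s + B)"
  obtains M where "bind_pmf M K = M" "integrable (measure_pmf M) f"
proof -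
  define s0 :: 'a where "s0 = undefined"
  \<comment> \<open>The number \<open>B / (1 - \<kappa>)\<close> is the fixed point of the map
    taking c to \<open>\<kappa>\<close> c + \<open>B\<close>. Adding \<open>f s0\<close> covers the
    initial point mass, so \<open>C\<close> bounds the mean of \<open>f\<close> at all
    times.\<close>
  define C where "C = f s0 + B / (1 - \<kappa>)"
  define \<mu> where "\<mu> n = ((\<lambda>P. bind_pmf P K) ^^ n) (return_pmf s0)" for n
  have \<mu>_Suc: "\<mu> (Suc n) = bind_pmf (\<mu> n) K" for n
    by (simp add: \<mu>_def)
  have C: "0 \<le> C" "f s0 \<le> C" "\<kappa> * C + B \<le> C"
  proof -
    have "\<kappa> * f s0 \<le> f s0"
      using \<kappa> nonneg[of s0] by (simp add: mult_left_le_one_le)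
    moreover have "\<kappa> * (B / (1 - \<kappa>)) + B = B / (1 - \<kappa>)"
      using \<kappa> by (simp add: field_simps)
    ultimately show "0 \<le> C" "f s0 \<le> C" "\<kappa> * C + B \<le> C"
      using \<kappa> B nonneg[of s0] by (simp_all add: C_def distrib_left)
  qed
  have \<mu>_le: "(\<integral>\<^sup>+s. ennreal (f s) \<partial>\<mu> n) \<le> ennreal C" for n
  proof (induction n)
    case 0
    show ?case
      using C by (simp add: \<mu>_def ennreal_leI)
  next
    case (Suc n)
    have "(\<integral>\<^sup>+s. ennreal (f s) \<partial>\<mu> (Suc n)) \<le> (\<integral>\<^sup>+s. ennreal \<kappa> * ennreal (f s) + ennreal B \<partial>\<mu> n)"
      unfolding \<mu>_Suc nn_integral_bind_pmf
      by (intro nn_integral_mono order_trans[OF drift]) (use \<kappa> B nonneg in \<open>simp add: ennreal_mult\<close>)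
    also have "\<dots> = ennreal \<kappa> * (\<integral>\<^sup>+s. ennreal (f s) \<partial>\<mu> n) + ennreal B"
      by (simp add: nn_integral_add nn_integral_cmult)
    also have "\<dots> \<le> ennreal \<kappa> * ennreal C + ennreal B"
      by (intro add_mono mult_left_mono Suc) auto
    also have "\<dots> = ennreal (\<kappa> * C + B)"
      using \<kappa> C B by (simp add: ennreal_mult)
    also have "\<dots> \<le> ennreal C"
      using C by (simp add: ennreal_leI)
    finally show ?case .
  qed
  have sum_le: "(\<Sum>s\<in>F. pmf (\<mu> n) s * f s) \<le> C" if "finite F" for F n
    using order_trans[OF sum_pmf_mult_le_nn_integral[OF that nonneg] \<mu>_le] C by simp
  have tight: "1 - C / c \<le> (\<Sum>s | f s \<le> c. pmf (\<mu> n) s)" if c: "0 < c" for c n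
  proof -
    have "measure (\<mu> n) {s. \<not> f s \<le> c} \<le> C / c"
    proof -
      have int: "integrable (\<mu> n) f"
        using \<mu>_le[of n] nonneg
        by (intro integrableI_nonneg) (auto intro: le_less_trans)
      have "measure (\<mu> n) {s. \<not> f s \<le> c} \<le> measure (\<mu> n) {s \<in> space (\<mu> n). f s \<ge> c}"
        by (intro measure_pmf.finite_measure_mono) auto
      also have "\<dots> \<le> (LINT s|\<mu> n. f s) / c"
        using int nonneg c by (intro integral_Markov_inequality_measure[where A = "{}"]) auto
      also have "\<dots> \<le> C / c"
      proof -
        have "ennreal (LINT s|\<mu> n. f s) \<le> ennreal C"
          using \<mu>_le[of n] nonneg by (simp add: nn_integral_eq_integral[OF int])
        then show ?thesis
          using C c by (simp add: divide_right_mono)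
      qed
      finally show ?thesis .
    qed
    moreover have "measure (\<mu> n) {s. f s \<le> c} + measure (\<mu> n) {s. \<not> f s \<le> c} = 1"
      using measure_pmf.prob_compl[of "{s. f s \<le> c}" "\<mu> n"]
      by (simp add: Compl_eq_Diff_UNIV[symmetric] Collect_neg_eq)
    ultimately show ?thesis
      using measure_measure_pmf_finite[OF sublevel[of c], of "\<mu> n"] by linarith
  qed
  \<comment> \<open>Averaging over \<open>Suc n\<close> terms avoids division by zero.\<close>
  define A where "A n s = (\<Sum>k<Suc n. pmf (\<mu> k) s) / real (Suc n)" for n s
  have average_le: "(\<Sum>k<Suc n. g k) / real (Suc n) \<le> c" if "\<And>k. g k \<le> c" for g n c
    using sum_bounded_above[of "{..<Suc n}" g c] that by (simp add: pos_divide_le_eq mult.commute)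
  have average_ge: "c \<le> (\<Sum>k<Suc n. g k) / real (Suc n)" if "\<And>k. c \<le> g k" for g n c
    using sum_bounded_below[of "{..<Suc n}" c g] that by (simp add: pos_le_divide_eq mult.commute)
  have A_sum: "(\<Sum>s\<in>F. A n s * g s) = (\<Sum>k<Suc n. \<Sum>s\<in>F. pmf (\<mu> k) s * g s) / real (Suc n)" for F n g
    unfolding A_def
    by (subst sum.swap) (simp add: sum_divide_distrib sum_distrib_right del: sum.lessThan_Suc)
  \<comment> \<open>A diagonal argument over the countable state space: the averages lie in [0, 1]
    at each state.\<close>
  obtain r :: "nat \<Rightarrow> nat" where r: "strict_mono r" and conv: "\<And>s. \<exists>l. (\<lambda>n. A (r n) s) \<longlonglongrightarrow> l"
  proof -
    have "A n s \<le> 1" "0 \<le> A n s" for n s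
      unfolding A_def by (intro average_le average_ge pmf_le_1 pmf_nonneg)+
    then have "norm (A n s) \<le> 1" for n s
      by simp
    then show ?thesis
      using function_convergent_subsequence[of UNIV A 1] that by auto
  qed
  define w where "w s = lim (\<lambda>n. A (r n) s)" for s
  have w: "(\<lambda>n. A (r n) s) \<longlonglongrightarrow> w s" for s
    using conv[of s] by (auto simp: w_def limI)
  have w_sum: "(\<lambda>n. \<Sum>s\<in>F. A (r n) s * g s) \<longlonglongrightarrow> (\<Sum>s\<in>F. w s * g s)" for F g
    by (intro tendsto_intros w)
  have w_nonneg: "0 \<le> w s" for s
    by (rule LIMSEQ_le_const[OF w]) (intro exI allI impI, unfold A_def, intro average_ge pmf_nonneg)
  have w_le: "(\<Sum>s\<in>F. w s * g s) \<le> c" if "\<And>k. (\<Sum>s\<in>F. pmf (\<mu> k) s * g s) \<le> c" for F g c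
    by (rule LIMSEQ_le_const2[OF w_sum[of g F]]) (intro exI allI impI, unfold A_sum, intro average_le that)
  have w_ge: "c \<le> (\<Sum>s\<in>F. w s * g s)" if "\<And>k. c \<le> (\<Sum>s\<in>F. pmf (\<mu> k) s * g s)" for F g c
    by (rule LIMSEQ_le_const[OF w_sum[of g F]]) (intro exI allI impI, unfold A_sum, intro average_ge that)
  obtain M where M: "\<And>s. pmf M s = w s"
  proof (rule pmf_of_tight_weights[of w])
    show "sum w F \<le> 1" if "finite F" for F
      using w_le[where F = F and g = "\<lambda>_. 1" and c = 1] that
      by (simp flip: measure_measure_pmf_finite)
    show "\<exists>F. finite F \<and> 1 - \<epsilon> \<le> sum w F" if \<epsilon>: "0 < \<epsilon>" for \<epsilon>
    proof (rule exI, rule conjI, rule sublevel)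
      \<comment> \<open>The numerator \<open>C + 1\<close> instead of \<open>C\<close> keeps the
        level positive even when \<open>C\<close> is 0.\<close>
      have "C / ((C + 1) / \<epsilon>) \<le> \<epsilon>"
        using \<epsilon> C by (simp add: field_simps)
      moreover have "1 - C / ((C + 1) / \<epsilon>) \<le> (\<Sum>s | f s \<le> (C + 1) / \<epsilon>. w s * 1)"
        by (rule w_ge) (use tight[of "(C + 1) / \<epsilon>"] \<epsilon> C in simp)
      ultimately show "1 - \<epsilon> \<le> sum w {s. f s \<le> (C + 1) / \<epsilon>}"
        by simp
    qed
  qed (use w_nonneg in auto)
  have "bind_pmf M K = M"
  proof (rule pmf_eqI)
    fix s
    define N where "N = {t. s \<in> set_pmf (K t)}"
    have bind: "pmf (bind_pmf P K) s = (\<Sum>t\<in>N. pmf P t * pmf (K t) s)" for P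
      unfolding pmf_bind
      by (subst integral_measure_pmf_real[where A = N])
         (use pred[of s] in \<open>auto simp: N_def set_pmf_iff mult.commute\<close>)
    \<comment> \<open>Applying the kernel shifts the average by one time step. All but the two end
      terms cancel, so the error vanishes as n grows; the finiteness of \<open>N\<close> lets the
      limit pass through the sum.\<close>
    have "(\<Sum>t\<in>N. A n t * pmf (K t) s) = A n s + (pmf (\<mu> (Suc n)) s - pmf (\<mu> 0) s) / real (Suc n)" for n
    proof -
      have "(\<Sum>k<Suc n. pmf (\<mu> (Suc k)) s) = (\<Sum>k<Suc n. pmf (\<mu> k) s) + (pmf (\<mu> (Suc n)) s - pmf (\<mu> 0) s)"
        using sum.lessThan_Suc_shift[of "\<lambda>k. pmf (\<mu> k) s" "Suc n"] by simp
      then show ?thesis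
        unfolding A_sum bind[symmetric] \<mu>_Suc[symmetric] by (simp add: A_def add_divide_distrib del: sum.lessThan_Suc)
    qed
    moreover have "(\<lambda>n. A (r n) s + (pmf (\<mu> (Suc (r n))) s - pmf (\<mu> 0) s) / real (Suc (r n))) \<longlonglongrightarrow> w s + 0"
    proof (intro tendsto_add w)
      have "(\<lambda>n. (pmf (\<mu> (Suc n)) s - pmf (\<mu> 0) s) / real (Suc n)) \<longlonglongrightarrow> 0"
      proof (rule Lim_null_comparison)
        show "\<forall>\<^sub>F n in sequentially. norm ((pmf (\<mu> (Suc n)) s - pmf (\<mu> 0) s) / real (Suc n)) \<le> 1 / real (Suc n)"
        proof (intro always_eventually allI)
          fix n
          have "\<bar>pmf (\<mu> (Suc n)) s - pmf (\<mu> 0) s\<bar> \<le> 1"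
            using pmf_nonneg[of "\<mu> (Suc n)" s] pmf_nonneg[of "\<mu> 0" s]
              pmf_le_1[of "\<mu> (Suc n)" s] pmf_le_1[of "\<mu> 0" s] by linarith
          then show "norm ((pmf (\<mu> (Suc n)) s - pmf (\<mu> 0) s) / real (Suc n)) \<le> 1 / real (Suc n)"
            by (simp add: divide_right_mono)
        qed
        show "(\<lambda>n. 1 / real (Suc n)) \<longlonglongrightarrow> 0"
          using LIMSEQ_inverse_real_of_nat by (simp add: inverse_eq_divide)
      qed
      then show "(\<lambda>n. (pmf (\<mu> (Suc (r n))) s - pmf (\<mu> 0) s) / real (Suc (r n))) \<longlonglongrightarrow> 0"
        by (rule LIMSEQ_subseq_LIMSEQ[OF _ r, unfolded o_def])
    qed
    ultimately have "(\<lambda>n. \<Sum>t\<in>N. A (r n) t * pmf (K t) s) \<longlonglongrightarrow> w s"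
      by simp
    with w_sum have "(\<Sum>t\<in>N. w t * pmf (K t) s) = w s"
      by (rule LIMSEQ_unique)
    then show "pmf (bind_pmf M K) s = pmf M s"
      by (simp add: bind M)
  qed
  moreover have "integrable (measure_pmf M) f"
  proof -
    \<comment> \<open>The uniform bound on finite partial sums survives the pointwise limit, as in
      Fatou's lemma.\<close>
    have "(\<Sum>s\<in>F. pmf M s * f s) \<le> C" if "finite F" for F
      unfolding M using sum_le[OF that] by (rule w_le)
    then have "(\<lambda>s. pmf M s * f s) summable_on UNIV"
      by (intro nonneg_bdd_above_summable_on)
         (auto simp: bdd_above_def intro!: mult_nonneg_nonneg nonneg)
    then have "Infinite_Set_Sum.abs_summable_on (\<lambda>s. pmf M s * f s) UNIV"
      using nonneg by (simp flip: abs_summable_equivalent)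
    then show ?thesis
      using nonneg unfolding measure_pmf_eq_density
      by (subst integrable_density) (auto simp: Infinite_Set_Sum.abs_summable_on_def)
  qed
  ultimately show thesis
    by (rule that)
qed

section \<open>The jump chain\<close>

locale bilateral_match =
  fixes lamH lamE pH pE :: real
  assumes lamH: "0 < lamH" and lamE: "0 < lamE"
    and pH: "0 < pH" "pH < 1" and pE: "0 < pE" "pE \<le> 1"
begin

text \<open>The probabilities that two given agents cannot form a 2-cycle: \<open>q\<close> for two
  H agents, \<open>r\<close> for a mixed pair, \<open>s\<close> for two E agents.\<close>

definition "q = 1 - pH\<^sup>2"
definition "r = 1 - pE * pH"
definition "s = 1 - pE\<^sup>2"

text \<open>Rates of the four kinds of jump. Priority for H partners is why \<open>downH\<close>
  does not depend on e, while \<open>downE\<close> carries the factors \<open>q ^ h\<close> and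
  \<open>r ^ h\<close>.\<close>

definition upH :: "nat \<Rightarrow> nat \<Rightarrow> real" where "upH h e = lamH * q ^ h * r ^ e"
definition downH :: "nat \<Rightarrow> real" where "downH h = lamH * (1 - q ^ h) + lamE * (1 - r ^ h)"
definition upE :: "nat \<Rightarrow> nat \<Rightarrow> real" where "upE h e = lamE * r ^ h * s ^ e"
definition downE :: "nat \<Rightarrow> nat \<Rightarrow> real" where
  "downE h e = lamH * q ^ h * (1 - r ^ e) + lamE * r ^ h * (1 - s ^ e)"

lemma q_bounds: "0 < q" "q < 1"
  using pH by (auto simp: q_def power_less_one_iff)

lemma r_bounds: "0 < r" "r < 1"
proof -
  have "pE * pH < 1"
    using pE pH mult_right_mono[of pE 1 pH] by linarith
  then show "0 < r" "r < 1"
    using pE pH by (simp_all add: r_def)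
qed

lemma s_bounds: "0 \<le> s" "s < 1"
  using pE by (auto simp: s_def power_le_one_iff)

lemma power_bounds:
  "0 < q ^ n" "q ^ n \<le> 1" "0 < r ^ n" "r ^ n \<le> 1" "0 \<le> s ^ n" "s ^ n \<le> 1"
  using q_bounds r_bounds s_bounds by (simp_all add: power_le_one)

lemma rates_nonneg: "0 \<le> upH h e" "0 \<le> downH h" "0 \<le> upE h e" "0 \<le> downE h e"
  using power_bounds[of h] power_bounds[of e] lamH lamE
  by (simp_all add: upH_def downH_def upE_def downE_def)

lemma rates_sum: "upH h e + downH h + upE h e + downE h e = lamH + lamE"
  by (simp add: upH_def downH_def upE_def downE_def algebra_simps)

text \<open>Every arrival changes the state, so the exit rate is \<open>lamH + lamE\<close> throughout and
  stationarity is invariance under the jump chain \<open>kernel\<close>.\<close>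

definition kernel :: "nat \<times> nat \<Rightarrow> (nat \<times> nat) pmf" where
  "kernel = (\<lambda>(h, e).
     bind_pmf (bernoulli_pmf (lamH / (lamH + lamE))) (\<lambda>typeH.
     bind_pmf (bernoulli_pmf (1 - (if typeH then q else r) ^ h)) (\<lambda>matchH.
     if matchH then return_pmf (h - 1, e)
     else bind_pmf (bernoulli_pmf (1 - (if typeH then r else s) ^ e)) (\<lambda>matchE.
       return_pmf (if matchE then (h, e - 1) else if typeH then (h + 1, e) else (h, e + 1))))))"

text \<open>The expectation of \<open>g\<close> after one jump, multiplied by the total rate
  \<open>lamH + lamE\<close>. Truncated subtraction is harmless, because \<open>downH\<close>
  vanishes at h = 0 and \<open>downE\<close> at e = 0.\<close>

definition transfer :: "(nat \<times> nat \<Rightarrow> real) \<Rightarrow> nat \<times> nat \<Rightarrow> real" where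
  "transfer g = (\<lambda>(h, e). upH h e * g (h + 1, e) + downH h * g (h - 1, e)
     + upE h e * g (h, e + 1) + downE h e * g (h, e - 1))"

lemma transfer_nonneg: "(\<And>t. 0 \<le> g t) \<Longrightarrow> 0 \<le> transfer g t"
  using rates_nonneg by (auto simp: transfer_def split: prod.split)

lemma nn_integral_kernel:
  assumes g: "\<And>t. 0 \<le> g t"
  shows "(\<integral>\<^sup>+t. ennreal (g t) \<partial>kernel x) = ennreal (transfer g x / (lamH + lamE))"
proof (cases x)
  case (Pair h e)
  have inner: "(\<integral>\<^sup>+t. ennreal (g t) \<partial>bind_pmf (bernoulli_pmf (1 - u ^ h)) (\<lambda>matchH.
       if matchH then return_pmf (h - 1, e)
       else bind_pmf (bernoulli_pmf (1 - v ^ e)) (\<lambda>matchE. return_pmf (if matchE then (h, e - 1) else y))))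
     = ennreal (g (h - 1, e) * (1 - u ^ h) + (g (h, e - 1) * (1 - v ^ e) + g y * v ^ e) * u ^ h)"
    if uv: "0 \<le> u" "u \<le> 1" "0 \<le> v" "v \<le> 1" for u v y
  proof -
    have [simp]: "u ^ h \<le> 1" "v ^ e \<le> 1" "0 \<le> u ^ h" "0 \<le> v ^ e"
      using uv by (simp_all add: power_le_one)
    show ?thesis
      by (simp add: g flip: ennreal_mult ennreal_plus)
  qed
  define c where "c = lamH / (lamH + lamE)"
  have c: "0 \<le> c" "c \<le> 1"
    using lamH lamE by (simp_all add: c_def)
  have c': "c * (lamH + lamE) = lamH" "(1 - c) * (lamH + lamE) = lamE"
    using lamH lamE by (simp_all add: c_def field_simps)
  define A1 where "A1 = g (h - 1, e) * (1 - q ^ h) + (g (h, e - 1) * (1 - r ^ e) + g (h + 1, e) * r ^ e) * q ^ h"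
  define A2 where "A2 = g (h - 1, e) * (1 - r ^ h) + (g (h, e - 1) * (1 - s ^ e) + g (h, e + 1) * s ^ e) * r ^ h"
  have nonneg: "0 \<le> A1" "0 \<le> A2"
    unfolding A1_def A2_def
    by (intro add_nonneg_nonneg mult_nonneg_nonneg g; use power_bounds in \<open>simp add: less_imp_le\<close>)+
  have "(\<integral>\<^sup>+t. ennreal (g t) \<partial>kernel x) = ennreal A1 * ennreal c + ennreal A2 * ennreal (1 - c)"
    unfolding Pair kernel_def prod.case nn_integral_bind_pmf[where M = "bernoulli_pmf (lamH / (lamH + lamE))"] c_def[symmetric]
    using c inner[of q r "(h + 1, e)"] inner[of r s "(h, e + 1)"] q_bounds r_bounds s_bounds
    by (simp add: A1_def A2_def)
  also have "\<dots> = ennreal (A1 * c + A2 * (1 - c))"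
    using c nonneg by (simp add: ennreal_mult)
  also have "A1 * c + A2 * (1 - c) = transfer g x / (lamH + lamE)"
  proof -
    have "(A1 * c + A2 * (1 - c)) * (lamH + lamE) = A1 * (c * (lamH + lamE)) + A2 * ((1 - c) * (lamH + lamE))"
      by (simp add: algebra_simps)
    also have "\<dots> = transfer g x"
      unfolding c' by (simp add: Pair A1_def A2_def transfer_def upH_def downH_def upE_def downE_def algebra_simps)
    finally show ?thesis
      using lamH lamE by (simp add: field_simps)
  qed
  finally show ?thesis .
qed

text \<open>Integrating the indicator of the target state against the kernel picks out the one
  matching jump rate.\<close>

lemma pmf_kernel: "pmf (kernel x) y = rate_BH lamH lamE pH pE x y / (lamH + lamE)"
proof (cases x; cases y)
  fix h e h' e' assume xy: "x = (h, e)" "y = (h', e')"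
  have "ennreal (pmf (kernel x) y) = (\<integral>\<^sup>+t. ennreal (indicator {y} t) \<partial>kernel x)"
    by (simp add: ennreal_indicator emeasure_pmf_single)
  also have "\<dots> = ennreal (transfer (indicator {y}) x / (lamH + lamE))"
    by (rule nn_integral_kernel) simp
  finally have "pmf (kernel x) y = transfer (indicator {y}) x / (lamH + lamE)"
    using lamH lamE transfer_nonneg[of "indicator {y}" x] by (simp add: ennreal_inj)
  also have "transfer (indicator {y}) x = rate_BH lamH lamE pH pE x y"
    by (cases h; cases e)
       (auto simp: xy transfer_def rate_BH_def upH_def downH_def upE_def downE_def
          q_def r_def s_def indicator_def)
  finally show ?thesis .
qed

lemma rate_BH_eq: "rate_BH lamH lamE pH pE x y = (lamH + lamE) * pmf (kernel x) y"
  using lamH lamE by (simp add: pmf_kernel)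

lemma finite_predecessors: "finite {x. y \<in> set_pmf (kernel x)}"
proof (cases y)
  case (Pair h e)
  have "{x. y \<in> set_pmf (kernel x)} \<subseteq> {..h + 1} \<times> {..e + 1}"
    by (auto simp: set_pmf_iff pmf_kernel rate_BH_def Pair split: if_splits)
  then show ?thesis
    by (rule finite_subset) simp
qed

text \<open>Both sides of the balance equation carry the common factor \<open>lamH + lamE\<close>.
  The inflow is a finite sum over predecessors, so \<open>has_sum\<close> reduces to an ordinary
  equation.\<close>

lemma stationary_iff_invariant:
  "stationary_for (rate_BH lamH lamE pH pE) M \<longleftrightarrow> bind_pmf M kernel = M"
proof -
  have "((\<lambda>y. rate_BH lamH lamE pH pE x y) has_sum (lamH + lamE)) UNIV" for x
  proof -
    have "Infinite_Set_Sum.abs_summable_on (pmf (kernel x)) UNIV"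
      by (rule pmf_abs_summable)
    then have "(pmf (kernel x) has_sum 1) UNIV"
      using infsetsum_pmf_eq_1[of "kernel x" UNIV] infsetsum_infsum[of "pmf (kernel x)" UNIV]
        abs_summable_summable abs_summable_equivalent[of "pmf (kernel x)" UNIV] has_sum_infsum[of "pmf (kernel x)" UNIV] by auto
    then show ?thesis
      using has_sum_cmult_right[of "pmf (kernel x)" UNIV 1 "lamH + lamE"] by (simp add: rate_BH_eq)
  qed
  then have out: "(\<Sum>\<^sub>\<infinity>y. rate_BH lamH lamE pH pE x y) = lamH + lamE" for x
    by (simp add: infsumI)
  have inflow: "((\<lambda>x. pmf M x * rate_BH lamH lamE pH pE x y) has_sum (lamH + lamE) * pmf (bind_pmf M kernel) y) UNIV" for y
  proof -
    let ?N = "{x. y \<in> set_pmf (kernel x)}"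
    have "pmf (bind_pmf M kernel) y = (\<Sum>x\<in>?N. pmf (kernel x) y * pmf M x)"
      unfolding pmf_bind
      by (rule integral_measure_pmf_real) (use finite_predecessors in \<open>auto simp: set_pmf_iff\<close>)
    then have "(lamH + lamE) * pmf (bind_pmf M kernel) y = (\<Sum>x\<in>?N. pmf M x * rate_BH lamH lamE pH pE x y)"
      by (simp add: sum_distrib_left rate_BH_eq mult_ac)
    then show ?thesis
      by (intro has_sum_finite_neutralI[where B = ?N])
         (use finite_predecessors in \<open>auto simp: rate_BH_eq set_pmf_iff\<close>)
  qed
  have inflow_iff: "((\<lambda>x. pmf M x * rate_BH lamH lamE pH pE x y) has_sum c) UNIV
      \<longleftrightarrow> (lamH + lamE) * pmf (bind_pmf M kernel) y = c" for y c
    using inflow[of y] has_sum_unique by blast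
  have "stationary_for (rate_BH lamH lamE pH pE) M
      \<longleftrightarrow> (\<forall>y. (lamH + lamE) * pmf (bind_pmf M kernel) y = (lamH + lamE) * pmf M y)"
    unfolding stationary_for_def out inflow_iff by (simp add: mult.commute)
  also have "\<dots> \<longleftrightarrow> bind_pmf M kernel = M"
    using lamH lamE by (auto intro: pmf_eqI)
  finally show ?thesis .
qed

text \<open>Whenever an agent of a type is waiting, its departure has positive rate: first all H
  agents leave, then all E agents.\<close>

lemma reach_empty: "(x, (0, 0)) \<in> {(x, y). y \<in> set_pmf (kernel x)}\<^sup>*"
proof -
  let ?R = "{(x, y). y \<in> set_pmf (kernel x)}"
  have pow: "q ^ n < 1" "r ^ n < 1" if "0 < n" for n
    using q_bounds r_bounds that by (simp_all add: power_less_one_iff)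
  have H: "((Suc h, e), (h, e)) \<in> ?R" for h e
  proof -
    have "0 < downH (Suc h)"
      using pow[of "Suc h"] lamH lamE unfolding downH_def
      by (intro add_pos_pos mult_pos_pos) simp_all
    then show ?thesis
      using lamH lamE by (simp add: set_pmf_iff pmf_kernel rate_BH_def downH_def q_def r_def)
  qed
  have E: "((h, Suc e), (h, e)) \<in> ?R" for h e
  proof -
    have "0 < downE h (Suc e)"
      using pow[of "Suc e"] power_bounds[of h] power_bounds[of "Suc e"] lamH lamE unfolding downE_def
      by (intro add_pos_nonneg mult_pos_pos mult_nonneg_nonneg) simp_all
    then show ?thesis
      using lamH lamE by (simp add: set_pmf_iff pmf_kernel rate_BH_def downE_def q_def r_def s_def)
  qed
  have "((h, e), (0, e)) \<in> ?R\<^sup>*" for h e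
    by (induction h) (auto intro: converse_rtrancl_into_rtrancl[OF H])
  moreover have "((0, e), (0, 0)) \<in> ?R\<^sup>*" for e
    by (induction e) (auto intro: converse_rtrancl_into_rtrancl[OF E])
  ultimately show ?thesis
    by (cases x) (auto intro: rtrancl_trans)
qed

section \<open>Exponential Lyapunov function and existence of the stationary distribution\<close>

definition "\<kappa> = max q (max r s)"

lemma \<kappa>_bounds: "0 < \<kappa>" "\<kappa> < 1" "q \<le> \<kappa>" "r \<le> \<kappa>" "s \<le> \<kappa>"
  using q_bounds r_bounds s_bounds by (auto simp: \<kappa>_def)

definition lyapunov :: "nat \<times> nat \<Rightarrow> real" where
  "lyapunov = (\<lambda>(h, e). (1 / \<kappa>) ^ (h + e))"

text \<open>Upward rates are at most the arrival rate times \<open>\<kappa> ^ (h + e)\<close>, which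
  cancels the growth of \<open>lyapunov\<close> and leaves the constant \<open>1 / \<kappa>\<close>.
  Downward jumps multiply \<open>lyapunov\<close> by \<open>\<kappa>\<close> and have total rate at
  most \<open>lamH + lamE\<close>.\<close>

lemma transfer_lyapunov:
  "transfer lyapunov x \<le> (lamH + lamE) * (\<kappa> * lyapunov x + 1 / \<kappa>)"
proof (cases x)
  case (Pair h e)
  define f where "f = lyapunov (h, e)"
  have f: "0 < f" "f * (\<kappa> ^ h * \<kappa> ^ e) = 1"
    using \<kappa>_bounds by (simp_all add: f_def lyapunov_def power_one_over flip: power_add)
  have up: "lyapunov (h + 1, e) = f / \<kappa>" "lyapunov (h, e + 1) = f / \<kappa>"
    by (simp_all add: f_def lyapunov_def)
  have down: "downH h * lyapunov (h - 1, e) = downH h * (\<kappa> * f)"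
      "downE h e * lyapunov (h, e - 1) = downE h e * (\<kappa> * f)"
    using \<kappa>_bounds by (cases h; cases e; simp add: f_def lyapunov_def downH_def downE_def)+
  have "upH h e * f \<le> lamH" "upE h e * f \<le> lamE"
  proof -
    have *: "q ^ h * r ^ e \<le> \<kappa> ^ h * \<kappa> ^ e" "r ^ h * s ^ e \<le> \<kappa> ^ h * \<kappa> ^ e"
      using \<kappa>_bounds q_bounds r_bounds s_bounds by (intro mult_mono power_mono; simp)+
    have "f * (q ^ h * r ^ e) \<le> 1" "f * (r ^ h * s ^ e) \<le> 1"
      using *[THEN mult_left_mono, of f] f by simp_all
    then have "lamH * (f * (q ^ h * r ^ e)) \<le> lamH * 1" "lamE * (f * (r ^ h * s ^ e)) \<le> lamE * 1"
      using lamH lamE by (intro mult_left_mono; simp)+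
    then show "upH h e * f \<le> lamH" "upE h e * f \<le> lamE"
      by (simp_all add: upH_def upE_def mult_ac)
  qed
  then have "(upH h e * f + upE h e * f) / \<kappa> \<le> (lamH + lamE) / \<kappa>"
    using \<kappa>_bounds by (intro divide_right_mono) auto
  moreover have "(downH h + downE h e) * (\<kappa> * f) \<le> (lamH + lamE) * (\<kappa> * f)"
    using rates_sum[of h e] rates_nonneg(1,3)[of h e] f \<kappa>_bounds by (intro mult_right_mono) auto
  ultimately show ?thesis
    unfolding Pair transfer_def prod.case up down f_def[symmetric]
    by (simp add: add_divide_distrib algebra_simps)
qed

text \<open>The drift condition yields an invariant distribution with integrable
  \<open>lyapunov\<close>. Uniqueness, through the reachable state (0, 0), identifies it with the
  definite description in \<open>stationary_BH\<close>.\<close>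

lemma stationary_BH_properties:
  defines "\<pi> \<equiv> stationary_BH lamH lamE pH pE"
  shows "bind_pmf \<pi> kernel = \<pi>" and "integrable (measure_pmf \<pi>) lyapunov"
proof -
  have nonneg: "0 \<le> lyapunov x" for x
    using \<kappa>_bounds by (auto simp: lyapunov_def split: prod.split)
  have sublevel: "finite {x. lyapunov x \<le> c}" for c
  proof -
    obtain n where n: "c < (1 / \<kappa>) ^ n"
      using real_arch_pow[of "1 / \<kappa>" c] \<kappa>_bounds by auto
    have "{x. lyapunov x \<le> c} \<subseteq> {..n} \<times> {..n}"
    proof
      fix x assume x: "x \<in> {x. lyapunov x \<le> c}"
      then have "(1 / \<kappa>) ^ (fst x + snd x) < (1 / \<kappa>) ^ n"
        using n by (simp add: lyapunov_def split: prod.splits)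
      then have "fst x + snd x < n"
        by (rule power_less_imp_less_exp[rotated]) (use \<kappa>_bounds in simp)
      then show "x \<in> {..n} \<times> {..n}"
        by (cases x) simp
    qed
    then show ?thesis
      by (rule finite_subset) simp
  qed
  have drift: "(\<integral>\<^sup>+y. ennreal (lyapunov y) \<partial>kernel x) \<le> ennreal (\<kappa> * lyapunov x + 1 / \<kappa>)" for x
    using transfer_lyapunov[of x] lamH lamE
    by (simp add: nn_integral_kernel nonneg ennreal_leI pos_divide_le_eq mult.commute)
  obtain M where M: "bind_pmf M kernel = M" "integrable (measure_pmf M) lyapunov"
    by (rule invariant_pmf_exists[OF nonneg sublevel finite_predecessors _ _ _ drift])
       (use \<kappa>_bounds in auto)
  have "\<pi> = M"
    unfolding \<pi>_def stationary_BH_def stationary_iff_invariant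
    by (rule the_equality) (auto intro: M invariant_pmf_unique reach_empty)
  with M show "bind_pmf \<pi> kernel = \<pi>" "integrable (measure_pmf \<pi>) lyapunov"
    by simp_all
qed

end

section \<open>Moment bounds\<close>

text \<open>Each of the first n terms of the geometric series is at least
  \<open>x ^ n\<close>.\<close>

lemma of_nat_mult_power_le:
  fixes x :: real
  assumes "0 \<le> x" "x < 1"
  shows "real n * x ^ n \<le> 1 / (1 - x)"
proof -
  have "real n * x ^ n \<le> (\<Sum>i<n. x ^ i)"
    using sum_bounded_below[of "{..<n}" "x ^ n" "\<lambda>i. x ^ i"] assms
    by (simp add: power_decreasing)
  also have "\<dots> = (1 - x ^ n) / (1 - x)"
    using assms by (simp add: one_diff_power_eq)
  also have "\<dots> \<le> 1 / (1 - x)"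
    using assms by (intro divide_right_mono) auto
  finally show ?thesis .
qed

lemma one_minus_power_le:
  fixes x :: real
  assumes "0 \<le> x" "x \<le> 1"
  shows "1 - (1 - x) ^ n \<le> real n * x"
  using Bernoulli_inequality[of "- x" n] assms by (simp add: algebra_simps)

lemma of_nat_le_square: "real n \<le> (real n)\<^sup>2"
  using of_nat_mono[OF le_square[of n], where 'a = real] by (simp add: power2_eq_square)

lemma of_nat_le_square_add:
  "real h \<le> (real h + real e)\<^sup>2" "real e \<le> (real h + real e)\<^sup>2"
  by (rule order_trans[OF of_nat_le_square], simp add: power_mono)+

context bilateral_match
begin

definition "\<pi> = stationary_BH lamH lamE pH pE"

abbreviation mean :: "(nat \<times> nat \<Rightarrow> real) \<Rightarrow> real" where
  "mean g \<equiv> measure_pmf.expectation \<pi> g"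

text \<open>With \<open>y\<close> the square root of \<open>1 / \<kappa>\<close>, squaring
  Bernoulli's bound for \<open>y ^ n\<close> dominates a quadratic by
  \<open>lyapunov\<close>.\<close>

lemma integrable_quadratic:
  assumes "\<And>h e. \<bar>g (h, e)\<bar> \<le> C * (1 + (real h + real e)\<^sup>2)"
  shows "integrable (measure_pmf \<pi>) g"
proof -
  define y where "y = sqrt (1 / \<kappa>)"
  have y: "1 < y" "y\<^sup>2 = 1 / \<kappa>"
    using \<kappa>_bounds by (simp_all add: y_def)
  have quadratic_le: "(real n)\<^sup>2 * (y - 1)\<^sup>2 \<le> (1 / \<kappa>) ^ n" for n
  proof -
    have "real n * (y - 1) \<le> y ^ n"
      using Bernoulli_inequality[of "y - 1" n] y by simp
    then have "(real n * (y - 1))\<^sup>2 \<le> (y ^ n)\<^sup>2"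
      using y by (intro power_mono) auto
    moreover have "(y ^ n)\<^sup>2 = (1 / \<kappa>) ^ n"
      unfolding y(2)[symmetric] by (simp add: mult.commute flip: power_mult)
    ultimately show ?thesis
      by (simp add: power_mult_distrib)
  qed
  have bound: "1 + (real h + real e)\<^sup>2 \<le> (1 + 1 / (y - 1)\<^sup>2) * lyapunov (h, e)" for h e
  proof -
    have "(real h + real e)\<^sup>2 \<le> lyapunov (h, e) / (y - 1)\<^sup>2"
      using quadratic_le[of "h + e"] y by (simp add: lyapunov_def pos_le_divide_eq)
    moreover have "1 \<le> lyapunov (h, e)"
      using \<kappa>_bounds by (simp add: lyapunov_def one_le_power)
    ultimately show ?thesis
      by (simp add: distrib_right)
  qed
  have "0 \<le> C"
    using assms[of 0 0] abs_ge_zero[of "g (0, 0)"] by simp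
  have "integrable (measure_pmf \<pi>) (\<lambda>x. C * ((1 + 1 / (y - 1)\<^sup>2) * lyapunov x))"
    unfolding \<pi>_def using stationary_BH_properties(2) by (intro integrable_mult_right)
  then show ?thesis
  proof (rule Bochner_Integration.integrable_bound)
    show "AE x in measure_pmf \<pi>. norm (g x) \<le> norm (C * ((1 + 1 / (y - 1)\<^sup>2) * lyapunov x))"
    proof (intro AE_I2)
      fix x :: "nat \<times> nat"
      obtain h e where x: "x = (h, e)"
        by (cases x)
      have "norm (g x) \<le> C * ((1 + 1 / (y - 1)\<^sup>2) * lyapunov x)"
        using order_trans[OF assms mult_left_mono[OF bound \<open>0 \<le> C\<close>]] by (simp add: x)
      then show "norm (g x) \<le> norm (C * ((1 + 1 / (y - 1)\<^sup>2) * lyapunov x))"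
        by simp
    qed
  qed simp
qed

lemma integrable_bounded:
  fixes g :: "nat \<times> nat \<Rightarrow> real"
  assumes "\<And>x. \<bar>g x\<bar> \<le> C"
  shows "integrable (measure_pmf \<pi>) g"
  by (rule measure_pmf.integrable_const_bound[where B = C]) (use assms in auto)

section \<open>Stationary balance and bounds on the influence of waiting E agents\<close>

definition generator :: "(nat \<times> nat \<Rightarrow> real) \<Rightarrow> nat \<times> nat \<Rightarrow> real" where
  "generator g = (\<lambda>(h, e). upH h e * (g (h + 1, e) - g (h, e)) + downH h * (g (h - 1, e) - g (h, e))
     + upE h e * (g (h, e + 1) - g (h, e)) + downE h e * (g (h, e - 1) - g (h, e)))"

lemma generator_eq: "generator g x = transfer g x - (lamH + lamE) * g x"
proof (cases x)
  case (Pair h e)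
  show ?thesis
    unfolding Pair rates_sum[of h e, symmetric]
    by (simp add: generator_def transfer_def algebra_simps)
qed

lemma generator_balance:
  assumes g: "\<And>x. 0 \<le> g x" and int: "integrable (measure_pmf \<pi>) g"
  shows "integrable (measure_pmf \<pi>) (generator g)" "mean (generator g) = 0"
proof -
  have "ennreal (mean g) = (\<integral>\<^sup>+x. ennreal (g x) \<partial>bind_pmf \<pi> kernel)"
    using stationary_BH_properties(1) nn_integral_eq_integral[OF int] g by (simp add: \<pi>_def)
  also have "\<dots> = (\<integral>\<^sup>+x. ennreal (transfer g x / (lamH + lamE)) \<partial>\<pi>)"
    by (simp add: nn_integral_kernel g)
  finally have "integrable (measure_pmf \<pi>) (\<lambda>x. transfer g x / (lamH + lamE))
      \<and> mean (\<lambda>x. transfer g x / (lamH + lamE)) = mean g"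
    using lamH lamE
    by (subst (asm) eq_commute, subst (asm) nn_integral_eq_integrable)
       (auto simp: transfer_nonneg g)
  moreover have "transfer g = (\<lambda>x. (lamH + lamE) * (transfer g x / (lamH + lamE)))"
    using lamH lamE by simp
  ultimately have transfer: "integrable (measure_pmf \<pi>) (transfer g)"
      "mean (transfer g) = (lamH + lamE) * mean g"
    by (metis integrable_mult_right, metis integral_mult_right_zero)
  show "integrable (measure_pmf \<pi>) (generator g)" "mean (generator g) = 0"
    unfolding generator_eq[abs_def] using transfer int by simp_all
qed

text \<open>The stationary probability that an arriving E agent finds no H partner.\<close>

definition "\<rho> = mean (\<lambda>(h, e). r ^ h)"

lemma \<rho>_nonneg: "0 \<le> \<rho>"
  unfolding \<rho>_def using power_bounds by (intro Bochner_Integration.integral_nonneg) (auto simp: less_imp_le)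

lemma integrable_rho: "integrable (measure_pmf \<pi>) (\<lambda>(h, e). r ^ h)"
  using power_bounds by (intro integrable_bounded[where C = 1]) (auto simp: less_imp_le)

lemma mean_mono:
  assumes "integrable (measure_pmf \<pi>) f" "integrable (measure_pmf \<pi>) g" "\<And>h e. f (h, e) \<le> g (h, e)"
  shows "mean f \<le> mean g"
  using assms by (intro integral_mono) auto

lemma integrable_qr: "integrable (measure_pmf \<pi>) (\<lambda>(h, e). q ^ h * (1 - r ^ e))"
proof (rule integrable_bounded[where C = 1])
  fix x :: "nat \<times> nat"
  show "\<bar>case x of (h, e) \<Rightarrow> q ^ h * (1 - r ^ e)\<bar> \<le> 1"
    using power_bounds by (auto split: prod.split simp: abs_mult less_imp_le intro!: mult_le_one)
qed

text \<open>The test function e says that E agents join and leave the queue at equal mean rates. The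
  joining rate is at most \<open>lamE * r ^ h\<close>; the departures caused by H arrivals are only
  part of the leaving rate.\<close>

lemma mean_qr_le: "lamH * mean (\<lambda>(h, e). q ^ h * (1 - r ^ e)) \<le> lamE * \<rho>"
proof -
  let ?g = "\<lambda>(h, e). real e"
  have int: "integrable (measure_pmf \<pi>) ?g"
  proof (rule integrable_quadratic[where C = 1])
    fix h e :: nat
    have "real e \<le> (real h + real e)\<^sup>2"
      by (rule of_nat_le_square_add)
    then show "\<bar>case (h, e) of (h, e) \<Rightarrow> real e\<bar> \<le> 1 * (1 + (real h + real e)\<^sup>2)"
      by simp
  qed
  have "mean (\<lambda>x. lamH * (case x of (h, e) \<Rightarrow> q ^ h * (1 - r ^ e)) + generator ?g x)
      \<le> mean (\<lambda>x. lamE * (case x of (h, e) \<Rightarrow> r ^ h))"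
  proof (rule mean_mono)
    fix h e :: nat
    have "generator ?g (h, e) = upE h e - downE h e"
      by (cases e) (simp_all add: generator_def downE_def algebra_simps)
    moreover have "upE h e \<le> lamE * r ^ h" "0 \<le> lamE * r ^ h * (1 - s ^ e)"
      using power_bounds lamE by (simp_all add: upE_def mult_left_le less_imp_le)
    ultimately show "lamH * (case (h, e) of (h, e) \<Rightarrow> q ^ h * (1 - r ^ e)) + generator ?g (h, e)
        \<le> lamE * (case (h, e) of (h, e) \<Rightarrow> r ^ h)"
      by (simp add: downE_def)
  qed (use integrable_rho integrable_qr generator_balance[of ?g] int in auto)
  moreover have "mean (generator ?g) = 0" "integrable (measure_pmf \<pi>) (generator ?g)"
    using generator_balance[of ?g] int by auto
  ultimately show ?thesis
    using integrable_rho integrable_qr by (simp add: \<rho>_def)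
qed

lemma integrable_er: "integrable (measure_pmf \<pi>) (\<lambda>(h, e). real e * r ^ h)"
proof (rule integrable_quadratic[where C = 1])
  fix h e :: nat
  have "real e * r ^ h \<le> real e"
    using power_bounds by (simp add: mult_left_le)
  moreover have "real e \<le> (real h + real e)\<^sup>2"
    by (rule of_nat_le_square_add)
  ultimately show "\<bar>case (h, e) of (h, e) \<Rightarrow> real e * r ^ h\<bar> \<le> 1 * (1 + (real h + real e)\<^sup>2)"
    using power_bounds by (simp add: less_imp_le)
qed

text \<open>The test function \<open>e (e + 1)\<close>: while \<open>H\<close> is small, waiting \<open>E\<close> agents quickly match
  each other.\<close>

lemma mean_er_le: "mean (\<lambda>(h, e). real e * r ^ h) \<le> (1 + 2 / pE\<^sup>2) * \<rho>"
proof -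
  let ?g = "\<lambda>(h, e). real e * (real e + 1)"
  have int: "integrable (measure_pmf \<pi>) ?g"
  proof (rule integrable_quadratic[where C = 2])
    fix h e :: nat
    have "real e \<le> (real h + real e)\<^sup>2"
      by (rule of_nat_le_square_add)
    moreover have "(real e)\<^sup>2 \<le> (real h + real e)\<^sup>2"
      by (simp add: power_mono)
    ultimately have "real e * (real e + 1) \<le> 2 * (real h + real e)\<^sup>2"
      by (simp only: power2_eq_square distrib_left mult_1_right)
    then show "\<bar>case (h, e) of (h, e) \<Rightarrow> real e * (real e + 1)\<bar> \<le> 2 * (1 + (real h + real e)\<^sup>2)"
      by simp
  qed
  have "mean (\<lambda>x. 2 * lamE * (case x of (h, e) \<Rightarrow> real e * r ^ h) + generator ?g x)
      \<le> mean (\<lambda>x. 2 * lamE * (1 + 2 / pE\<^sup>2) * (case x of (h, e) \<Rightarrow> r ^ h))"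
  proof (rule mean_mono)
    fix h e :: nat
    \<comment> \<open>With e (e + 1) in place of the square of e, the downward increment is exactly
      -2e.\<close>
    have gen: "generator ?g (h, e) = upE h e * (2 * real e + 2) - downE h e * (2 * real e)"
      by (cases e) (simp_all add: generator_def downE_def algebra_simps)
    \<comment> \<open>Here 1 - \<open>s\<close> is the square of \<open>pE\<close>, so the geometric
      bound is applied to both copies of e \<open>s ^ e\<close>; one copy comes from joining E
      agents, the other from failed E matches.\<close>
    have "(real e + 1) * s ^ e + real e * s ^ e \<le> 1 + 2 / pE\<^sup>2"
      using of_nat_mult_power_le[OF s_bounds, of e] power_bounds[of e] by (simp add: s_def algebra_simps)
    then have "2 * lamE * r ^ h * ((real e + 1) * s ^ e + real e * s ^ e) \<le> 2 * lamE * r ^ h * (1 + 2 / pE\<^sup>2)"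
      using lamE power_bounds[of h] by (intro mult_left_mono) auto
    moreover have "0 \<le> lamH * q ^ h * (1 - r ^ e) * (2 * real e)"
      using lamH power_bounds[of h] power_bounds[of e] by simp
    ultimately show "2 * lamE * (case (h, e) of (h, e) \<Rightarrow> real e * r ^ h) + generator ?g (h, e)
        \<le> 2 * lamE * (1 + 2 / pE\<^sup>2) * (case (h, e) of (h, e) \<Rightarrow> r ^ h)"
      unfolding gen by (simp add: upE_def downE_def algebra_simps)
  qed (use integrable_rho integrable_er generator_balance[of ?g] int in auto)
  moreover have "mean (generator ?g) = 0" "integrable (measure_pmf \<pi>) (generator ?g)"
    using generator_balance[of ?g] int by auto
  ultimately have "lamE * mean (\<lambda>(h, e). real e * r ^ h) \<le> lamE * ((1 + 2 / pE\<^sup>2) * \<rho>)"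
    using integrable_rho integrable_er by (simp add: \<rho>_def)
  then show ?thesis
    using lamE by simp
qed

text \<open>The test function \<open>r\<^sup>h\<close>: on the scale \<open>1 / pH\<close> the \<open>H\<close> queue grows at rate close to
  \<open>lamH\<close> and is matched at rate at most about \<open>lamE\<close>.\<close>

lemma \<rho>_le:
  "\<rho> * (lamH - lamE / r - lamH * pE * pH * (1 + 2 / pE\<^sup>2)) \<le> lamH * (pH / pE) * (1 / r + 1)"
proof -
  let ?g = "\<lambda>(h, e). r ^ h"
  define f where "f x = (case x of (h, e) \<Rightarrow> lamH * (pE * pH) * (real e * r ^ h) + (lamE / r - lamH) * r ^ h)" for x :: "nat \<times> nat"
  have f_int: "integrable (measure_pmf \<pi>) f"
    using integrable_er integrable_rho by (simp add: f_def[abs_def] case_prod_beta')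
  have f_mean: "mean f = lamH * (pE * pH) * mean (\<lambda>(h, e). real e * r ^ h) + (lamE / r - lamH) * \<rho>"
    using integrable_er integrable_rho by (simp add: f_def[abs_def] case_prod_beta' \<rho>_def)
  note balance = generator_balance[OF _ integrable_rho]
  have gen: "integrable (measure_pmf \<pi>) (generator ?g)" "mean (generator ?g) = 0"
    using power_bounds by (auto intro!: balance simp: less_imp_le)
  have "mean (\<lambda>x. generator ?g x / (1 - r)) \<le> mean (\<lambda>x. f x + lamH * (pH / pE) * (1 / r + 1))"
  proof (rule mean_mono)
    fix h e :: nat
    \<comment> \<open>Both increments of \<open>r ^ h\<close> contain 1 - \<open>r\<close>, which is
      \<open>pE * pH\<close>; dividing it out makes the remaining inequality of order one.\<close>
    have "generator ?g (h, e) = (1 - r) * (r ^ h * downH h / r - r ^ h * upH h e)"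
      using r_bounds by (cases h) (simp_all add: generator_def downH_def field_simps)
    then have g: "generator ?g (h, e) / (1 - r) = r ^ h * downH h / r - r ^ h * upH h e"
      using r_bounds by simp
    \<comment> \<open>Matches between H agents are negligible at this scale: \<open>r ^ h\<close>
      confines h to order \<open>1 / pH\<close>, where the chance of an H partner is only of order
      \<open>pH\<close>.\<close>
    have q_le: "r ^ h * (1 - q ^ h) \<le> pH / pE"
    proof -
      have "r ^ h * (1 - q ^ h) \<le> r ^ h * (real h * pH\<^sup>2)"
        using one_minus_power_le[of "pH\<^sup>2" h] pH power_bounds[of h]
        by (intro mult_left_mono) (simp_all add: q_def power_le_one)
      also have "\<dots> = (real h * r ^ h) * pH\<^sup>2"
        by simp
      also have "\<dots> \<le> 1 / (1 - r) * pH\<^sup>2"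
        using of_nat_mult_power_le[of r h] r_bounds by (intro mult_right_mono) auto
      also have "\<dots> = pH / pE"
        using pH pE by (simp add: r_def power2_eq_square)
      finally show ?thesis .
    qed
    have e_le: "r ^ h * (1 - r ^ e) \<le> pE * pH * (real e * r ^ h)"
      using mult_left_mono[OF one_minus_power_le[of "pE * pH" e], of "r ^ h"] r_bounds power_bounds[of h] pE pH
      by (simp add: r_def mult_ac)
    have "r ^ h * downH h \<le> lamH * (pH / pE) + lamE * r ^ h"
    proof -
      have "lamE * (r ^ h * (1 - r ^ h)) \<le> lamE * r ^ h"
        using lamE power_bounds[of h] by (intro mult_left_mono mult_left_le) auto
      then show ?thesis
        using mult_left_mono[OF q_le, of lamH] lamH by (simp add: downH_def algebra_simps)
    qed
    then have "r ^ h * downH h / r \<le> (lamH * (pH / pE) + lamE * r ^ h) / r"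
      using r_bounds by (intro divide_right_mono) auto
    moreover have "r ^ h * upH h e \<ge> lamH * r ^ h - lamH * (pH / pE) - lamH * (pE * pH * (real e * r ^ h))"
    proof -
      \<comment> \<open>This gives the union bound: \<open>q ^ h * r ^ e\<close> is at least 1 minus
        the two failure terms.\<close>
      have "0 \<le> r ^ h * ((1 - q ^ h) * (1 - r ^ e))"
        using power_bounds by (simp add: less_imp_le)
      then have "lamH * (r ^ h - r ^ h * (1 - q ^ h) - r ^ h * (1 - r ^ e)) \<le> lamH * (r ^ h * (q ^ h * r ^ e))"
        using lamH by (intro mult_left_mono) (auto simp: algebra_simps)
      then show ?thesis
        using mult_left_mono[OF q_le, of lamH] mult_left_mono[OF e_le, of lamH] lamH
        by (simp add: upH_def algebra_simps)
    qed
    ultimately show "generator ?g (h, e) / (1 - r) \<le> f (h, e) + lamH * (pH / pE) * (1 / r + 1)"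
      unfolding g f_def by (simp add: algebra_simps add_divide_distrib)
  qed (use f_int gen in auto)
  then have "0 \<le> mean f + lamH * (pH / pE) * (1 / r + 1)"
    using f_int gen by simp
  moreover have "lamH * (pE * pH) * mean (\<lambda>(h, e). real e * r ^ h)
      \<le> lamH * (pE * pH) * ((1 + 2 / pE\<^sup>2) * \<rho>)"
    using mean_er_le lamH pE pH by (intro mult_left_mono) auto
  ultimately show ?thesis
    unfolding f_mean by (simp add: algebra_simps)
qed

section \<open>Concentration of the number of waiting H agents\<close>

lemma integrable_H: "integrable (measure_pmf \<pi>) (\<lambda>(h, e). real h)"
proof (rule integrable_quadratic[where C = 1])
  fix h e :: nat
  have "real h \<le> (real h + real e)\<^sup>2"
    by (rule of_nat_le_square_add)
  then show "\<bar>case (h, e) of (h, e) \<Rightarrow> real h\<bar> \<le> 1 * (1 + (real h + real e)\<^sup>2)"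
    by simp
qed

lemma integrable_H_q: "integrable (measure_pmf \<pi>) (\<lambda>(h, e). (real h - m) * (c - q ^ h))"
proof (rule Bochner_Integration.integrable_bound)
  show "integrable (measure_pmf \<pi>) (\<lambda>x. (\<bar>m\<bar> + (case x of (h, e) \<Rightarrow> real h)) * (\<bar>c\<bar> + 1))"
    using integrable_H by simp
  show "AE x in measure_pmf \<pi>. norm (case x of (h, e) \<Rightarrow> (real h - m) * (c - q ^ h))
      \<le> norm ((\<bar>m\<bar> + (case x of (h, e) \<Rightarrow> real h)) * (\<bar>c\<bar> + 1))"
  proof (intro AE_I2)
    fix x :: "nat \<times> nat"
    obtain h e where x: "x = (h, e)"
      by (cases x)
    have "\<bar>real h - m\<bar> * \<bar>c - q ^ h\<bar> \<le> (\<bar>m\<bar> + real h) * (\<bar>c\<bar> + 1)"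
      using power_bounds(1,2)[of h] by (intro mult_mono) linarith+
    then show "norm (case x of (h, e) \<Rightarrow> (real h - m) * (c - q ^ h))
        \<le> norm ((\<bar>m\<bar> + (case x of (h, e) \<Rightarrow> real h)) * (\<bar>c\<bar> + 1))"
      by (simp add: x abs_mult)
  qed
qed simp

text \<open>The test function \<open>(h - m)\<^sup>2\<close>, where \<open>\<theta>\<close> is the fraction of \<open>H\<close> arrivals that must not
  find an \<open>H\<close> partner for the fluid drift \<open>2 lamH \<theta> - lamH - lamE\<close> to vanish.\<close>

lemma mean_H_q_le:
  assumes m: "0 \<le> m"
  defines "\<theta> \<equiv> (lamH + lamE) / (2 * lamH)"
  shows "2 * lamH * mean (\<lambda>(h, e). (real h - m) * (\<theta> - q ^ h))
    \<le> (lamH + lamE) / 2 + m * lamE * \<rho> + lamE / (pE * pH)"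
proof -
  let ?g = "\<lambda>(h, e). (real h - m)\<^sup>2"
  have int: "integrable (measure_pmf \<pi>) ?g"
  proof (rule integrable_quadratic[where C = "2 * (1 + m\<^sup>2)"])
    fix h e :: nat
    have "(real h - m)\<^sup>2 \<le> 2 * (real h)\<^sup>2 + 2 * m\<^sup>2"
      using zero_le_power2[of "real h + m"] by (simp add: power2_eq_square algebra_simps)
    moreover have "(real h)\<^sup>2 \<le> (real h + real e)\<^sup>2" "0 \<le> m\<^sup>2 * (real h + real e)\<^sup>2"
      by (simp_all add: power_mono)
    ultimately have "(real h - m)\<^sup>2 \<le> 2 * (real h + real e)\<^sup>2 + 2 * m\<^sup>2 + 2 * (m\<^sup>2 * (real h + real e)\<^sup>2) + 2"
      by linarith
    then show "\<bar>case (h, e) of (h, e) \<Rightarrow> (real h - m)\<^sup>2\<bar> \<le> 2 * (1 + m\<^sup>2) * (1 + (real h + real e)\<^sup>2)"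
      by (simp add: algebra_simps)
  qed
  have gen: "integrable (measure_pmf \<pi>) (generator ?g)" "mean (generator ?g) = 0"
    using int by (auto intro!: generator_balance)
  define f where "f x = 2 * lamH * (case x of (h, e) \<Rightarrow> (real h - m) * (\<theta> - q ^ h)) + generator ?g x / 2" for x
  have f: "integrable (measure_pmf \<pi>) f"
      "mean f = 2 * lamH * mean (\<lambda>(h, e). (real h - m) * (\<theta> - q ^ h))"
    using integrable_H_q[of m \<theta>] gen by (simp_all add: f_def[abs_def])
  have "mean f \<le> mean (\<lambda>x. (lamH + lamE) / 2 + m * lamH * (case x of (h, e) \<Rightarrow> q ^ h * (1 - r ^ e))
      + lamE / (pE * pH))"
  proof (rule mean_mono[OF f(1)])
    fix h e :: nat
    have up: "generator ?g (h, e) / 2 = (upH h e + downH h) / 2 - (real h - m) * (downH h - upH h e)"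
      by (cases h) (simp_all add: generator_def downH_def power2_eq_square field_simps)
    have "lamH * \<theta> * 2 = lamH + lamE"
      using lamH by (simp add: \<theta>_def)
    \<comment> \<open>The net downward drift is the fluid part, plus H arrivals matched to waiting E
      agents, minus E arrivals that find no H partner.\<close>
    then have drift: "downH h - upH h e = 2 * lamH * (\<theta> - q ^ h) + lamH * (q ^ h * (1 - r ^ e)) - lamE * r ^ h"
      by (simp add: upH_def downH_def algebra_simps)
    \<comment> \<open>A linear inequality on opaque terms: \<open>x\<close> and \<open>y\<close> are
      dropped by sign, \<open>z\<close> is bounded by the geometric estimate, and \<open>t\<close>
      is kept for \<open>mean_qr_le\<close>.\<close>
    have combine: "u \<le> v \<Longrightarrow> 0 \<le> x \<Longrightarrow> 0 \<le> y \<Longrightarrow> z \<le> w \<Longrightarrow> f' = u / 2 - x + t + z - y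
        \<Longrightarrow> f' \<le> v / 2 + t + w" for u v w x y z t f' :: real
      by linarith
    have "upH h e + downH h \<le> lamH + lamE"
      using rates_sum[of h e] rates_nonneg(3,4)[of h e] by linarith
    moreover have "0 \<le> real h * (lamH * (q ^ h * (1 - r ^ e)))" "0 \<le> m * (lamE * r ^ h)"
      using power_bounds lamH lamE m by (simp_all add: less_imp_le)
    moreover have "lamE * (real h * r ^ h) \<le> lamE / (pE * pH)"
      using mult_left_mono[OF of_nat_mult_power_le[of r h], of lamE] r_bounds lamE by (simp add: r_def)
    moreover have "f (h, e) = (upH h e + downH h) / 2 - real h * (lamH * (q ^ h * (1 - r ^ e)))
        + m * lamH * (q ^ h * (1 - r ^ e)) + lamE * (real h * r ^ h) - m * (lamE * r ^ h)"
      unfolding f_def up drift prod.case by (simp only: algebra_simps)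
    ultimately show "f (h, e) \<le> (lamH + lamE) / 2
        + m * lamH * (case (h, e) of (h, e) \<Rightarrow> q ^ h * (1 - r ^ e)) + lamE / (pE * pH)"
      unfolding prod.case by (rule combine)
  qed (use integrable_qr in simp)
  also have "\<dots> = (lamH + lamE) / 2 + m * (lamH * mean (\<lambda>(h, e). q ^ h * (1 - r ^ e))) + lamE / (pE * pH)"
    using integrable_qr by simp
  also have "\<dots> \<le> (lamH + lamE) / 2 + m * (lamE * \<rho>) + lamE / (pE * pH)"
    using mean_qr_le m by (intro add_mono mult_left_mono order_refl) auto
  finally show ?thesis
    unfolding f(2) by (simp add: mult_ac)
qed

text \<open>Since \<open>q powr m = \<theta>\<close>, the factors h - \<open>m\<close> and
  \<open>\<theta> - q ^ h\<close> have the same sign. Once the scaled deviation exceeds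
  \<open>\<delta>\<close>, the second factor has absolute value at least
  \<open>\<theta> * (1 - exp (- \<delta>))\<close>, so the product controls the deviation.\<close>

lemma abs_deviation_le:
  assumes m: "q powr m = \<theta>" and \<theta>: "0 < \<theta>" and \<delta>: "0 < \<delta>"
  shows "pH\<^sup>2 * \<bar>real h - m\<bar> \<le> \<delta> + pH\<^sup>2 * ((real h - m) * (\<theta> - q ^ h)) / (\<theta> * (1 - exp (- \<delta>)))"
proof -
  define c where "c = \<theta> * (1 - exp (- \<delta>))"
  have c: "0 < c"
    using \<theta> \<delta> by (simp add: c_def)
  have ln_q: "ln q \<le> - pH\<^sup>2"
    using ln_le_minus_one[of q] q_bounds by (simp add: q_def)
  have q_pow: "q ^ h = \<theta> * q powr (real h - m)"
    using q_bounds m \<theta> by (simp add: powr_diff powr_realpow)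
  have same_sign: "0 \<le> (real h - m) * (\<theta> - q ^ h)"
  proof (cases "m \<le> real h")
    case True
    then have "q powr (real h - m) \<le> 1"
      using q_bounds by (simp add: powr_le1)
    then show ?thesis
      using True \<theta> unfolding q_pow by (intro mult_nonneg_nonneg) (simp_all add: mult_left_le)
  next
    case False
    then have "1 \<le> q powr (real h - m)"
      using q_bounds powr_mono'[of "real h - m" 0 q] by simp
    then show ?thesis
      using False \<theta> unfolding q_pow by (intro mult_nonpos_nonpos) simp_all
  qed
  have "pH\<^sup>2 * \<bar>real h - m\<bar> \<le> pH\<^sup>2 * ((real h - m) * (\<theta> - q ^ h)) / c" if far: "\<delta> < pH\<^sup>2 * \<bar>real h - m\<bar>"
  proof -
    have "c \<le> \<bar>\<theta> - q ^ h\<bar>"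
    proof (cases "m \<le> real h")
      case True
      then have "(real h - m) * ln q \<le> - \<delta>"
        using far mult_left_mono[OF ln_q, of "real h - m"] by (simp add: mult.commute)
      then have "q powr (real h - m) \<le> exp (- \<delta>)"
        using q_bounds by (simp add: powr_def)
      then have "\<theta> * (1 - exp (- \<delta>)) \<le> \<theta> * (1 - q powr (real h - m))"
        using \<theta> by (intro mult_left_mono) auto
      then show ?thesis
        unfolding q_pow c_def by (simp add: algebra_simps)
    next
      case False
      then have "\<delta> \<le> (real h - m) * ln q"
        using far mult_left_mono_neg[OF ln_q, of "real h - m"] by (simp add: mult.commute algebra_simps)
      then have "exp \<delta> \<le> q powr (real h - m)"
        using q_bounds by (simp add: powr_def)
      \<comment> \<open>The gap exp \<open>\<delta>\<close> - 1 found below \<open>m\<close> is at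
        least the gap 1 - exp(-\<open>\<delta>\<close>) found above it, so one constant serves both
        sides.\<close>
      moreover have "2 \<le> exp \<delta> + exp (- \<delta>)"
      proof -
        have "0 \<le> (exp (\<delta> / 2) - exp (- \<delta> / 2))\<^sup>2"
          by simp
        also have "\<dots> = exp \<delta> + exp (- \<delta>) - 2"
          by (simp add: power2_eq_square algebra_simps flip: exp_add)
        finally show ?thesis
          by simp
      qed
      ultimately have "\<theta> * (1 - exp (- \<delta>)) \<le> \<theta> * (q powr (real h - m) - 1)"
        using \<theta> by (intro mult_left_mono) auto
      then show ?thesis
        unfolding q_pow c_def by (simp add: algebra_simps)
    qed
    then have "(pH\<^sup>2 * \<bar>real h - m\<bar>) * c \<le> (pH\<^sup>2 * \<bar>real h - m\<bar>) * \<bar>\<theta> - q ^ h\<bar>"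
      by (intro mult_left_mono) auto
    also have "\<dots> = pH\<^sup>2 * ((real h - m) * (\<theta> - q ^ h))"
      using same_sign by (simp add: mult.assoc flip: abs_mult)
    finally show ?thesis
      using c by (simp add: pos_le_divide_eq)
  qed
  moreover have "0 \<le> pH\<^sup>2 * ((real h - m) * (\<theta> - q ^ h)) / c"
    using same_sign c by simp
  ultimately show ?thesis
    unfolding c_def[symmetric] using \<delta> by linarith
qed

text \<open>Here \<open>m\<close> is the zero of the fluid drift. The distance of the mean from
  \<open>m\<close> is at most the mean distance, which the previous two bounds control.\<close>

lemma wait_H_BH_estimate:
  assumes less: "lamE < lamH" and \<delta>: "0 < \<delta>"
  defines "m \<equiv> ln ((lamH + lamE) / (2 * lamH)) / ln q"
  shows "\<bar>pH\<^sup>2 * (lamH * wait_H_BH lamH lamE pH pE) - pH\<^sup>2 * m\<bar>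
    \<le> \<delta> + pH\<^sup>2 * ((lamH + lamE) / 2 + m * lamE * \<rho> + lamE / (pE * pH))
          / ((lamH + lamE) * (1 - exp (- \<delta>)))"
proof -
  define \<theta> where "\<theta> = (lamH + lamE) / (2 * lamH)"
  have \<theta>: "0 < \<theta>" "\<theta> < 1" "2 * lamH * \<theta> = lamH + lamE"
    using lamH lamE less by (simp_all add: \<theta>_def)
  have m: "0 \<le> m" "q powr m = \<theta>"
    using q_bounds \<theta> by (simp_all add: m_def \<theta>_def[symmetric] divide_nonpos_neg powr_def)
  define G where "G = mean (\<lambda>(h, e). (real h - m) * (\<theta> - q ^ h))"
  define c where "c = 1 - exp (- \<delta>)"
  have c: "0 < c"
    using \<delta> by (simp add: c_def)
  have "lamH * wait_H_BH lamH lamE pH pE = mean (\<lambda>(h, e). real h)"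
    using lamH by (simp add: wait_H_BH_def \<pi>_def)
  then have "pH\<^sup>2 * (lamH * wait_H_BH lamH lamE pH pE) - pH\<^sup>2 * m
      = mean (\<lambda>x. pH\<^sup>2 * ((case x of (h, e) \<Rightarrow> real h) - m))"
    using integrable_H by (simp add: right_diff_distrib)
  then have "\<bar>pH\<^sup>2 * (lamH * wait_H_BH lamH lamE pH pE) - pH\<^sup>2 * m\<bar>
      \<le> mean (\<lambda>x. \<bar>pH\<^sup>2 * ((case x of (h, e) \<Rightarrow> real h) - m)\<bar>)"
    by (simp only: integral_abs_bound)
  also have "\<dots> \<le> mean (\<lambda>x. \<delta> + pH\<^sup>2 * (case x of (h, e) \<Rightarrow> (real h - m) * (\<theta> - q ^ h)) / (\<theta> * c))"
    using integrable_H integrable_H_q[of m \<theta>] abs_deviation_le[OF m(2) \<theta>(1) \<delta>]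
    by (intro mean_mono) (simp_all add: abs_mult c_def)
  also have "\<dots> = \<delta> + pH\<^sup>2 * G / (\<theta> * c)"
    using integrable_H_q[of m \<theta>] by (simp add: G_def)
  also have "\<dots> = \<delta> + pH\<^sup>2 * (2 * lamH * G) / ((lamH + lamE) * c)"
    using lamH \<theta> c by (simp flip: \<theta>(3))
  also have "\<dots> \<le> \<delta> + pH\<^sup>2 * ((lamH + lamE) / 2 + m * lamE * \<rho> + lamE / (pE * pH)) / ((lamH + lamE) * c)"
    using mean_H_q_le[OF m(1)] lamH lamE c unfolding G_def \<theta>_def
    by (intro add_left_mono divide_right_mono mult_left_mono) auto
  finally show ?thesis
    by (simp add: c_def)
qed

end

section \<open>The limit as \<open>pH\<close> tends to 0\<close>

text \<open>For fixed \<open>\<delta>\<close> the remaining error vanishes with p, and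
  \<open>\<delta>\<close> is arbitrary. The scaled centre converges because ln(1 - x) behaves like
  -x near 0.\<close>

lemma tendsto_wait_H_BH:
  fixes lamH lamE pE :: real
  assumes lamE: "0 < lamE" and less: "lamE < lamH" and pE: "0 < pE" "pE \<le> 1"
  shows "((\<lambda>p. p\<^sup>2 * wait_H_BH lamH lamE p pE) \<longlongrightarrow> ln (2 * lamH / (lamH + lamE)) / lamH) (at_right 0)"
proof -
  define \<rho>' where "\<rho>' = (\<lambda>p. bilateral_match.\<rho> lamH lamE p pE)"
  define l where "l = ln ((lamH + lamE) / (2 * lamH))"
  define m where "m p = l / ln (1 - p\<^sup>2)" for p :: real
  have model: "\<forall>\<^sub>F p in at_right 0. bilateral_match lamH lamE p pE"
    using assms by (auto simp: eventually_at_right_field bilateral_match_def intro!: exI[of _ 1])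
  have \<rho>': "(\<rho>' \<longlongrightarrow> 0) (at_right 0)"
  proof (rule tendsto_sandwich[where f = "\<lambda>_. 0"])
    let ?U = "\<lambda>p. lamH * (p / pE) * (1 / (1 - pE * p) + 1)"
    let ?D = "\<lambda>p. lamH - lamE / (1 - pE * p) - lamH * pE * p * (1 + 2 / pE\<^sup>2)"
    have D: "(?D \<longlongrightarrow> lamH - lamE / (1 - pE * 0) - lamH * pE * 0 * (1 + 2 / pE\<^sup>2)) (at_right 0)"
      by (intro tendsto_intros) simp
    have U: "(?U \<longlongrightarrow> lamH * (0 / pE) * (1 / (1 - pE * 0) + 1)) (at_right 0)"
      using pE by (intro tendsto_intros) simp_all
    show "((\<lambda>p. ?U p / ?D p) \<longlongrightarrow> 0) (at_right 0)"
      using tendsto_divide[OF U D] less by simp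
    \<comment> \<open>The limit of \<open>?D\<close> is \<open>lamH - lamE\<close>; this is where
      the assumption on the rates makes the bound on \<open>\<rho>\<close> effective.\<close>
    have "\<forall>\<^sub>F p in at_right 0. 0 < ?D p"
      using order_tendstoD(1)[OF D, of 0] less by simp
    with model show "\<forall>\<^sub>F p in at_right 0. \<rho>' p \<le> ?U p / ?D p"
    proof eventually_elim
      case (elim p)
      then interpret bilateral_match lamH lamE p pE
        by simp
      have "\<rho>' p * ?D p \<le> ?U p"
        using \<rho>_le by (simp only: \<rho>'_def r_def)
      then show ?case
        using elim(2) by (simp only: pos_le_divide_eq)
    qed
    show "\<forall>\<^sub>F p in at_right 0. 0 \<le> \<rho>' p"
      using model by eventually_elim (simp add: \<rho>'_def bilateral_match.\<rho>_nonneg)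
  qed simp
  have m: "((\<lambda>p. p\<^sup>2 * m p) \<longlongrightarrow> - l) (at_right 0)"
  proof -
    have "((\<lambda>p::real. p\<^sup>2 / ln (1 - p\<^sup>2)) \<longlongrightarrow> -1) (at_right 0)"
      by real_asymp
    from tendsto_mult_left[OF this, of l] show ?thesis
      by (simp add: m_def[abs_def] mult_ac)
  qed
  have diff: "((\<lambda>p. p\<^sup>2 * (lamH * wait_H_BH lamH lamE p pE) - p\<^sup>2 * m p) \<longlongrightarrow> 0) (at_right 0)"
  proof (rule tendstoI)
    fix \<epsilon> :: real assume \<epsilon>: "0 < \<epsilon>"
    define K where "K = (lamH + lamE) * (1 - exp (- (\<epsilon> / 2)))"
    have K: "0 < K"
      using lamE less \<epsilon> by (simp add: K_def)
    \<comment> \<open>The factor of p squared is distributed so that each term converges: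
      \<open>m p\<close> alone grows like 1 over p squared and is tamed by it, and the vanishing
      \<open>\<rho>'\<close> finishes that term.\<close>
    define err where "err p = (p\<^sup>2 * ((lamH + lamE) / 2) + (p\<^sup>2 * m p) * lamE * \<rho>' p + p * (lamE / pE)) / K" for p
    have "(err \<longlongrightarrow> (0\<^sup>2 * ((lamH + lamE) / 2) + (- l) * lamE * 0 + 0 * (lamE / pE)) / K) (at_right 0)"
      unfolding err_def using K by (intro tendsto_intros m \<rho>') simp
    then have "(err \<longlongrightarrow> 0) (at_right 0)"
      by simp
    then have "\<forall>\<^sub>F p in at_right 0. err p < \<epsilon> / 2"
      using \<epsilon> by (rule order_tendstoD(2)[OF _ half_gt_zero])
    with model show "\<forall>\<^sub>F p in at_right 0. dist (p\<^sup>2 * (lamH * wait_H_BH lamH lamE p pE) - p\<^sup>2 * m p) 0 < \<epsilon>"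
    proof eventually_elim
      case (elim p)
      then interpret bilateral_match lamH lamE p pE
        by simp
      have "p\<^sup>2 * ((lamH + lamE) / 2 + m p * lamE * \<rho> + lamE / (pE * p)) / K = err p"
        using pH by (simp add: err_def \<rho>'_def algebra_simps power2_eq_square)
      then show ?case
        using wait_H_BH_estimate[OF less, of "\<epsilon> / 2"] \<epsilon> elim
        by (simp add: m_def l_def K_def q_def dist_real_def)
    qed
  qed
  have "((\<lambda>p. (p\<^sup>2 * (lamH * wait_H_BH lamH lamE p pE) - p\<^sup>2 * m p + p\<^sup>2 * m p) / lamH) \<longlongrightarrow> (0 + - l) / lamH) (at_right 0)"
    using lamE less by (intro tendsto_intros diff m) simp
  moreover have "- l = ln (2 * lamH / (lamH + lamE))"
    using lamE less by (simp add: l_def ln_div)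
  ultimately show ?thesis
    using lamE less by simp
qed

section \<open>Monotonicity of the limit\<close>

definition threshold_fun :: "real \<Rightarrow> real" where
  "threshold_fun x = (x + 1) * ln (2 - 2 / (x + 1))"

text \<open>The derivative at z is ln(2z / (z + 1)) + 1/z. By ln u >= 1 - 1/u it is at least (z + 1)
  / (2z), which is positive.\<close>

lemma threshold_fun_less:
  assumes "0 < x" "x < y"
  shows "threshold_fun x < threshold_fun y"
proof (rule DERIV_pos_imp_increasing[OF assms(2)])
  fix z assume "x \<le> z" "z \<le> y"
  then have z: "0 < z" "0 < 2 - 2 / (z + 1)"
    using assms(1) by (simp_all add: field_simps)
  have inner: "((\<lambda>x. 2 - 2 / (x + 1)) has_real_derivative 2 / (z + 1)\<^sup>2) (at z)"
    using z by (auto intro!: derivative_eq_intros simp: power2_eq_square)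
  have "((\<lambda>x. x + 1) has_real_derivative 1) (at z)"
    by (auto intro!: derivative_eq_intros)
  moreover have "(z + 1) * (1 / (2 - 2 / (z + 1)) * (2 / (z + 1)\<^sup>2)) + 1 * ln (2 - 2 / (z + 1))
      = ln (2 - 2 / (z + 1)) + 1 / z"
    using z(1) by (simp add: divide_simps power2_eq_square) (simp add: algebra_simps)
  ultimately have "(threshold_fun has_real_derivative ln (2 - 2 / (z + 1)) + 1 / z) (at z)"
    unfolding threshold_fun_def[abs_def]
    by (intro DERIV_cong[OF DERIV_mult'[OF _ DERIV_chain2[OF DERIV_ln_divide[OF z(2)] inner]]])
  moreover have "0 < ln (2 - 2 / (z + 1)) + 1 / z"
  proof -
    have "1 - 1 / (2 - 2 / (z + 1)) \<le> ln (2 - 2 / (z + 1))"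
      using ln_le_minus_one[of "1 / (2 - 2 / (z + 1))"] z(2) by (simp add: ln_div)
    moreover have "1 - 1 / (2 - 2 / (z + 1)) + 1 / z = (z + 1) / (2 * z)"
      using z by (simp add: field_simps)
    moreover have "0 < (z + 1) / (2 * z)"
      using z by simp
    ultimately show ?thesis
      by linarith
  qed
  ultimately show "\<exists>D. (threshold_fun has_real_derivative D) (at z) \<and> 0 < D"
    by blast
qed

lemma threshold_exists:
  obtains c where "2.175 \<le> c" "c \<le> 2.185" "threshold_fun c = 1"
proof -
  \<comment> \<open>At x = 2.175 the argument of the logarithm is 174/127 and 1 / (x + 1) is 40/127.
    Taking an eighth root makes the quadratic Taylor bound sharp enough.\<close>
  have "ln (174 / 127 :: real) \<le> 40 / 127"
  proof -
    have "(174 / 127 :: real) \<le> (1 + 5 / 127 + (5 / 127)\<^sup>2 / 2) ^ 8"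
      by (simp add: field_simps)
    also have "\<dots> \<le> exp (5 / 127) ^ 8"
      by (intro power_mono exp_lower_Taylor_quadratic) simp_all
    also have "\<dots> = exp (40 / 127)"
      by (simp flip: exp_of_nat_mult)
    finally show ?thesis
      using ln_le_cancel_iff[of "174 / 127" "exp (40 / 127 :: real)"] by simp
  qed
  then have lower: "threshold_fun 2.175 \<le> 1"
    by (simp add: threshold_fun_def)
  \<comment> \<open>At x = 2.185 these numbers are 874/637 and 200/637; with a 32nd root the linear
    bound for exp suffices.\<close>
  have "200 / 637 \<le> ln (874 / 637 :: real)"
  proof -
    have "(637 / 874 :: real) \<le> (1 - 25 / 2548) ^ 32"
      by (simp add: field_simps)
    also have "\<dots> \<le> exp (- 25 / 2548) ^ 32"
      using exp_ge_add_one_self[of "- 25 / 2548"] by (intro power_mono) simp_all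
    also have "\<dots> = exp (- (200 / 637))"
      by (simp flip: exp_of_nat_mult)
    finally have "exp (200 / 637) \<le> (874 / 637 :: real)"
      by (simp add: exp_minus field_simps)
    then show ?thesis
      by (subst ln_ge_iff) simp_all
  qed
  then have upper: "1 \<le> threshold_fun 2.185"
    by (simp add: threshold_fun_def)
  have "continuous_on {2.175..2.185} threshold_fun"
    unfolding threshold_fun_def by (intro continuous_intros) (auto simp: field_simps)
  with lower upper obtain c where "2.175 \<le> c" "c \<le> 2.185" "threshold_fun c = 1"
    using IVT'[of threshold_fun "2.175" 1 "2.185"] by auto
  then show thesis
    by (rule that)
qed

text \<open>The quotient rule gives (b / (x + b) - ln(2x / (x + b))) over x squared. Scaling the
  numerator by (x + b) / b turns it into \<open>1 - threshold_fun (x / b)\<close>, so the sign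
  depends on x / b only.\<close>

lemma limit_wait_derivative:
  fixes b x :: real
  assumes "0 < b" "0 < x"
  shows "((\<lambda>x. ln (2 * x / (x + b)) / x) has_real_derivative
    (1 - threshold_fun (x / b)) * (b / ((x + b) * x\<^sup>2))) (at x)"
proof -
  have arg: "2 - 2 / (x / b + 1) = 2 * x / (x + b)"
    using assms by (simp add: field_simps)
  have "((\<lambda>x. 2 * x / (x + b)) has_real_derivative 2 * b / (x + b)\<^sup>2) (at x)"
    using assms by (auto intro!: derivative_eq_intros simp: power2_eq_square algebra_simps)
  then have "((\<lambda>x. ln (2 * x / (x + b))) has_real_derivative
      1 / (2 * x / (x + b)) * (2 * b / (x + b)\<^sup>2)) (at x)"
    using assms by (intro DERIV_chain2[OF DERIV_ln_divide]) simp_all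
  moreover have "1 / (2 * x / (x + b)) * (2 * b / (x + b)\<^sup>2) = b / (x * (x + b))"
    using assms by (simp add: divide_simps power2_eq_square)
  ultimately have "((\<lambda>x. ln (2 * x / (x + b))) has_real_derivative b / (x * (x + b))) (at x)"
    by simp
  from DERIV_divide[OF this DERIV_ident]
  have "((\<lambda>x. ln (2 * x / (x + b)) / x) has_real_derivative
      (b / (x * (x + b)) * x - ln (2 * x / (x + b)) * 1) / (x * x)) (at x)"
    using assms by simp
  moreover have "(b / (x * (x + b)) * x - ln (2 * x / (x + b)) * 1) / (x * x)
      = (b / (x + b) - ln (2 * x / (x + b))) / x\<^sup>2"
    using assms by (simp add: power2_eq_square)
  ultimately have "((\<lambda>x. ln (2 * x / (x + b)) / x) has_real_derivative
      (b / (x + b) - ln (2 * x / (x + b))) / x\<^sup>2) (at x)"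
    by simp
  moreover have "1 - threshold_fun (x / b) = (x + b) / b * (b / (x + b) - ln (2 * x / (x + b)))"
  proof -
    have "b \<noteq> 0" "x + b \<noteq> 0"
      using assms by auto
    then have "x / b + 1 = (x + b) / b" "(x + b) / b * (b / (x + b)) = 1"
      by (simp add: field_simps, simp)
    then show ?thesis
      unfolding threshold_fun_def arg by (simp only: right_diff_distrib)
  qed
  then have "(b / (x + b) - ln (2 * x / (x + b))) / x\<^sup>2
      = (1 - threshold_fun (x / b)) * (b / ((x + b) * x\<^sup>2))"
    using assms by simp
  ultimately show ?thesis
    by simp
qed

theorem corollary2:
  fixes lamE pE :: real
  assumes "lamE > 0" and "0 < pE" and "pE \<le> 1"
  shows "\<exists>xstar::real.
    (\<forall>x::real. x + 1 \<noteq> 0 \<and> 2 - 2 / (x + 1) > 0 \<and> (x + 1) * ln (2 - 2 / (x + 1)) = 1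
       \<longleftrightarrow> x = xstar) \<and>
    \<bar>xstar - 2.18\<bar> \<le> 0.005 \<and>
    (\<exists>L::real \<Rightarrow> real.
      (\<forall>lamH > lamE.
         ((\<lambda>pH. pH\<^sup>2 * wait_H_BH lamH lamE pH pE) \<longlongrightarrow> L lamH) (at_right 0)) \<and>
      strict_mono_on {lamE<..<xstar * lamE} L \<and>
      strict_antimono_on {xstar * lamE<..} L)"
proof -
  obtain c where c: "2.175 \<le> c" "c \<le> 2.185" "threshold_fun c = 1"
    by (rule threshold_exists)
  define L where "L x = ln (2 * x / (x + lamE)) / x" for x
  have less_one: "threshold_fun x < 1" if "0 < x" "x < c" for x
    using threshold_fun_less[OF that] c by simp
  have greater_one: "1 < threshold_fun x" if "c < x" for x
    using threshold_fun_less[of c x] that c by simp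
  have DERIV_L: "(L has_real_derivative
      (1 - threshold_fun (x / lamE)) * (lamE / ((x + lamE) * x\<^sup>2))) (at x)" if "0 < x" for x
    unfolding L_def using limit_wait_derivative[OF assms(1) that] .
  have root: "x + 1 \<noteq> 0 \<and> 2 - 2 / (x + 1) > 0 \<and> (x + 1) * ln (2 - 2 / (x + 1)) = 1 \<longleftrightarrow> x = c" for x
  proof
    assume x: "x + 1 \<noteq> 0 \<and> 2 - 2 / (x + 1) > 0 \<and> (x + 1) * ln (2 - 2 / (x + 1)) = 1"
    \<comment> \<open>Below -1 the logarithm is positive and the product negative; between -1 and 0
      the argument of the logarithm is not positive. So only the range where
      \<open>threshold_fun\<close> is increasing remains.\<close>
    have "0 < x"
    proof (rule ccontr)
      assume "\<not> 0 < x"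
      show False
      proof (cases "x + 1 < 0")
        case True
        then have "1 < 2 - 2 / (x + 1)"
          by (simp add: field_simps)
        then have "(x + 1) * ln (2 - 2 / (x + 1)) < 0"
          using True by (intro mult_neg_pos ln_gt_zero)
        then show False
          using x by simp
      next
        case False
        then have "0 < x + 1"
          using x by linarith
        then have "2 - 2 / (x + 1) \<le> 0"
          using \<open>\<not> 0 < x\<close> by (simp add: field_simps)
        then show False
          using x by simp
      qed
    qed
    moreover have "threshold_fun x = 1"
      using x by (simp add: threshold_fun_def)
    ultimately show "x = c"
      using less_one[of x] greater_one[of x] by (cases x c rule: linorder_cases) auto
  next
    assume "x = c"
    then show "x + 1 \<noteq> 0 \<and> 2 - 2 / (x + 1) > 0 \<and> (x + 1) * ln (2 - 2 / (x + 1)) = 1"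
      using c by (simp add: threshold_fun_def field_simps)
  qed
  have close: "\<bar>c - 2.18\<bar> \<le> 0.005"
    using c(1,2) by (simp add: abs_if)
  have limit: "((\<lambda>pH. pH\<^sup>2 * wait_H_BH lamH lamE pH pE) \<longlongrightarrow> L lamH) (at_right 0)" if "lamE < lamH" for lamH
    unfolding L_def using tendsto_wait_H_BH[OF assms(1) that assms(2,3)] .
  have "strict_mono_on {lamE<..<c * lamE} L"
  proof (rule monotone_onI)
    fix x y assume xy: "x \<in> {lamE<..<c * lamE}" "y \<in> {lamE<..<c * lamE}" "x < y"
    show "L x < L y"
    proof (rule DERIV_pos_imp_increasing[OF xy(3)])
      fix z assume "x \<le> z" "z \<le> y"
      then have z: "0 < z" "z / lamE < c"
        using xy assms(1) by (auto simp: pos_divide_less_eq)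
      then have "0 < (1 - threshold_fun (z / lamE)) * (lamE / ((z + lamE) * z\<^sup>2))"
        using less_one[of "z / lamE"] assms(1) by simp
      then show "\<exists>D. (L has_real_derivative D) (at z) \<and> 0 < D"
        using DERIV_L[OF z(1)] by blast
    qed
  qed
  moreover have "strict_antimono_on {c * lamE<..} L"
  proof (rule monotone_onI)
    fix x y assume xy: "x \<in> {c * lamE<..}" "y \<in> {c * lamE<..}" "x < y"
    show "L y < L x"
    proof (rule DERIV_neg_imp_decreasing[OF xy(3)])
      fix z assume "x \<le> z" "z \<le> y"
      then have "c * lamE < z"
        using xy by simp
      moreover have "0 < c * lamE"
        using assms(1) c by simp
      ultimately have z: "0 < z" "c < z / lamE"
        using assms(1) by (simp_all add: pos_less_divide_eq)
      then have "(1 - threshold_fun (z / lamE)) * (lamE / ((z + lamE) * z\<^sup>2)) < 0"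
        using greater_one[of "z / lamE"] assms(1) by (intro mult_neg_pos) simp_all
      then show "\<exists>D. (L has_real_derivative D) (at z) \<and> D < 0"
        using DERIV_L[OF z(1)] by blast
    qed
  qed
  ultimately show ?thesis
    using root close limit by blast
qed

end
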